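(* Let $S$ be a closed, connected, oriented surface of genus $\tau\geq 2$, let $h$ be a hyperbolic metric on $S$ and let $q_{1}$ be a non-zero quadratic differential on $S$, holomorphic for the complex structure compatible with $h$. For $t>0$ let $\lambda_{t}$ be the positive principal curvature of the unique maximal surface $\Sigma_{t}$ embedded in the GHMC anti-de Sitter manifold $M_{t}$ parameterised by $(h,tq_{1})\in T^{*}\mathrm{Teich}(S)$. Then, outside the zeros of $q_{1}$, $\lambda_{t}$ increases monotonically to $1$ when $t$ goes to $+\infty$.
   Context: A GHMC (globally hyperbolic maximal Cauchy-compact) anti-de Sitter manifold is a Lorentzian $3$-manifold of constant sectional curvature $-1$ containing an embedded closed oriented surface (Cauchy surface) meeting every inextensible causal curve in exactly one point, and maximal under isometric embeddings sending a Cauchy surface to a Cauchy surface. Every GHMC anti-de Sitter manifold contains a unique embedded maximal surface (i.e. space-like with vanishing mean curvature). GHMC structures on $S\times\mathbb{R}$ (up to diffeomorphisms isotopic to the identity) are parameterised by pairs $(h,q)\in T^{*}\mathrm{Teich}(S)$, $h$ hyperbolic and $q$ a holomorphic quadratic differential for the conformal structure of $h$: the manifold corresponding to $(h,q)$ is the one whose maximal surface has induced metric $I=e^{2u}h$ and shape operator $B=I^{-1}\Re(q)$, where $u:S\to\mathbb{R}$ is the unique smooth solution of $$\Delta_{h}u=e^{2u}-e^{-2u}\|q\|_{h}^{2}-1 .$$ Here $\Delta_{h}$ is the non-positive Laplacian, and $\|q\|_{h}=|f|e^{-2v}$ if $q=f\,dz^{2}$ and $h=e^{2v}|dz|^{2}$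 in a conformal coordinate $z$. $\Re(q)$ is the symmetric bilinear form given by the real part of $q$. The operator $B$ is self-adjoint and traceless, with eigenvalues $\pm\lambda$; the positive principal curvature is $\lambda=\sqrt{-\det B}\geq 0$, a function on $S$ (vanishing exactly at the zeros of $q$). *)

theory Defs
  imports "HOL-Complex_Analysis.Complex_Analysis" "HOL-Homology.Homology"
begin

section \<open>Smooth manifolds\<close>

text \<open>
  For open \<open>U\<close> this is infinite differentiability: the Frechet derivative exists everywhere on \<open>U\<close>
  and all its directional components are again smooth on \<open>U\<close>. All sets to which it is applied below
  are open.
\<close>

coinductive smooth_on :: "'a::real_normed_vector set \<Rightarrow> ('a \<Rightarrow> 'b::real_normed_vector) \<Rightarrow> bool"
  for U where
  "(\<And>x. x \<in> U \<Longrightarrow> f differentiable (at x)) \<Longrightarrow>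
   (\<And>v. smooth_on U (\<lambda>x. frechet_derivative f (at x) v)) \<Longrightarrow> smooth_on U f"

text \<open>
  A chart is a domain together with a coordinate map into the Euclidean model space \<open>'e\<close>;
  the dimension of a manifold is the dimension of \<open>'e\<close>. Surfaces are modelled on \<open>complex\<close>,
  space-times on \<open>real ^ 3\<close>.
\<close>

type_synonym ('a, 'e) chart = "'a set \<times> ('a \<Rightarrow> 'e)"

record ('a, 'e) mfd =
  mtop :: "'a topology"
  charts :: "('a, 'e) chart set"

definition chart_image :: "('a, 'e) chart \<Rightarrow> 'e set" where
  "chart_image c = snd c ` fst c"

definition chart_inv :: "('a, 'e) chart \<Rightarrow> 'e \<Rightarrow> 'a" where
  "chart_inv c = inv_into (fst c) (snd c)"

definition is_chart :: "'a topology \<Rightarrow> ('a, 'e::euclidean_space) chart \<Rightarrow> bool" where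
  "is_chart X c \<longleftrightarrow> openin X (fst c) \<and> open (chart_image c) \<and>
     homeomorphic_map (subtopology X (fst c)) (top_of_set (chart_image c)) (snd c)"

definition in_charts ::
    "('a, 'e) chart \<Rightarrow> ('b, 'f) chart \<Rightarrow> ('a \<Rightarrow> 'b) \<Rightarrow> 'e \<Rightarrow> 'f" where
  "in_charts c d f = snd d \<circ> f \<circ> chart_inv c"

abbreviation transition :: "('a, 'e) chart \<Rightarrow> ('a, 'e) chart \<Rightarrow> 'e \<Rightarrow> 'e" where
  "transition c d \<equiv> in_charts c d (\<lambda>p. p)"

definition maximal_atlas ::
    "(('a, 'e) chart \<Rightarrow> ('a, 'e) chart \<Rightarrow> bool) \<Rightarrow> ('a, 'e::euclidean_space) mfd \<Rightarrow> bool" where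
  "maximal_atlas R M \<longleftrightarrow>
     (\<forall>c\<in>charts M. is_chart (mtop M) c) \<and>
     (\<Union>c\<in>charts M. fst c) = topspace (mtop M) \<and>
     (\<forall>c\<in>charts M. \<forall>d\<in>charts M. R c d) \<and>
     (\<forall>c. is_chart (mtop M) c \<and> (\<forall>d\<in>charts M. R c d \<and> R d c) \<longrightarrow> c \<in> charts M)"

definition smooth_compatible ::
    "('a, 'e::euclidean_space) chart \<Rightarrow> ('a, 'e) chart \<Rightarrow> bool" where
  "smooth_compatible c d \<longleftrightarrow> smooth_on (snd c ` (fst c \<inter> fst d)) (transition c d)"

definition smooth_manifold :: "('a, 'e::euclidean_space) mfd \<Rightarrow> bool" where
  "smooth_manifold M \<longleftrightarrow> Hausdorff_space (mtop M) \<and> second_countable (mtop M) \<and>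
     maximal_atlas smooth_compatible M"

definition chart_at :: "('a, 'e) mfd \<Rightarrow> 'a \<Rightarrow> ('a, 'e) chart" where
  "chart_at M p = (SOME c. c \<in> charts M \<and> p \<in> fst c)"

definition smooth_map ::
    "('a, 'e::euclidean_space) mfd \<Rightarrow> ('b, 'f::euclidean_space) mfd \<Rightarrow> ('a \<Rightarrow> 'b) \<Rightarrow> bool" where
  "smooth_map M N f \<longleftrightarrow> continuous_map (mtop M) (mtop N) f \<and>
     (\<forall>c\<in>charts M. \<forall>d\<in>charts N. smooth_on (snd c ` (fst c \<inter> f -` fst d)) (in_charts c d f))"

definition smooth_embedding ::
    "('a, 'e::euclidean_space) mfd \<Rightarrow> ('b, 'f::euclidean_space) mfd \<Rightarrow> ('a \<Rightarrow> 'b) \<Rightarrow> bool" where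
  "smooth_embedding M N f \<longleftrightarrow> smooth_map M N f \<and> embedding_map (mtop M) (mtop N) f \<and>
     (\<forall>c\<in>charts M. \<forall>d\<in>charts N. \<forall>p\<in>fst c \<inter> f -` fst d.
        inj (frechet_derivative (in_charts c d f) (at (snd c p))))"


section \<open>Oriented surfaces\<close>

definition endo_det :: "(complex \<Rightarrow> complex) \<Rightarrow> real" where
  "endo_det A = Re (A 1) * Im (A \<i>) - Re (A \<i>) * Im (A 1)"

definition endo_trace :: "('e::euclidean_space \<Rightarrow> 'e) \<Rightarrow> real" where
  "endo_trace A = (\<Sum>b\<in>Basis. A b \<bullet> b)"

definition oriented_compatible :: "('a, complex) chart \<Rightarrow> ('a, complex) chart \<Rightarrow> bool" where
  "oriented_compatible c d \<longleftrightarrow> smooth_compatible c d \<and>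
     (\<forall>x\<in>snd c ` (fst c \<inter> fst d). 0 < endo_det (frechet_derivative (transition c d) (at x)))"

text \<open>An oriented surface carries the maximal atlas of its positively oriented charts.\<close>

definition closed_oriented_surface :: "('a, complex) mfd \<Rightarrow> bool" where
  "closed_oriented_surface S \<longleftrightarrow> Hausdorff_space (mtop S) \<and> second_countable (mtop S) \<and>
     compact_space (mtop S) \<and> maximal_atlas oriented_compatible S"

text \<open>The genus of a closed connected oriented surface is half its first Betti number.\<close>

definition has_genus :: "'a topology \<Rightarrow> nat \<Rightarrow> bool" where
  "has_genus X \<tau> \<longleftrightarrow> homology_group 1 X \<cong> free_Abelian_group {..<2 * \<tau>}"


section \<open>Pseudo-Riemannian metrics\<close>

text \<open>
  A metric on a manifold is given by its local expressions: \<open>g c x v w\<close> is the product of the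
  coordinate vectors \<open>v\<close>, \<open>w\<close> at the point with coordinate \<open>x\<close> in the chart \<open>c\<close>.
\<close>

type_synonym ('a, 'e) metric = "('a, 'e) chart \<Rightarrow> 'e \<Rightarrow> 'e \<Rightarrow> 'e \<Rightarrow> real"

definition metric_tensor :: "('a, 'e::euclidean_space) mfd \<Rightarrow> ('a, 'e) metric \<Rightarrow> bool" where
  "metric_tensor M g \<longleftrightarrow>
     (\<forall>c\<in>charts M.
        (\<forall>x\<in>chart_image c. bilinear (g c x) \<and> (\<forall>v w. g c x v w = g c x w v)) \<and>
        (\<forall>v w. smooth_on (chart_image c) (\<lambda>x. g c x v w))) \<and>
     (\<forall>c\<in>charts M. \<forall>d\<in>charts M. \<forall>p\<in>fst c \<inter> fst d. \<forall>v w.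
        g c (snd c p) v w =
        g d (snd d p) (frechet_derivative (transition c d) (at (snd c p)) v)
                      (frechet_derivative (transition c d) (at (snd c p)) w))"

definition riemannian_metric :: "('a, 'e::euclidean_space) mfd \<Rightarrow> ('a, 'e) metric \<Rightarrow> bool" where
  "riemannian_metric M g \<longleftrightarrow> metric_tensor M g \<and>
     (\<forall>c\<in>charts M. \<forall>x\<in>chart_image c. \<forall>v. v \<noteq> 0 \<longrightarrow> 0 < g c x v v)"

text \<open>Signature \<open>(n - 1, 1)\<close>: positive definite on the orthogonal complement of a time-like vector.\<close>

definition lorentzian_metric :: "('a, 'e::euclidean_space) mfd \<Rightarrow> ('a, 'e) metric \<Rightarrow> bool" where
  "lorentzian_metric M g \<longleftrightarrow> metric_tensor M g \<and>
     (\<forall>c\<in>charts M. \<forall>x\<in>chart_image c. \<exists>e. g c x e e < 0 \<and>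
        (\<forall>v. g c x e v = 0 \<and> v \<noteq> 0 \<longrightarrow> 0 < g c x v v))"

text \<open>
  The next four notions take a metric \<open>G\<close> in a coordinate domain. \<open>christoffel G x v w\<close> is the
  Levi-Civita derivative in direction \<open>v\<close> of the field with constant coordinates \<open>w\<close>
  (Koszul formula); \<open>curvature G x v w z\<close> is
  \<open>\<nabla>\<^sub>v \<nabla>\<^sub>w z - \<nabla>\<^sub>w \<nabla>\<^sub>v z\<close> for fields with constant coordinates.
\<close>

definition christoffel ::
    "('e \<Rightarrow> 'e \<Rightarrow> 'e \<Rightarrow> real) \<Rightarrow> 'e \<Rightarrow> 'e \<Rightarrow> 'e \<Rightarrow> 'e::euclidean_space" where
  "christoffel G x v w = (THE y. \<forall>z. G x y z =
     (frechet_derivative (\<lambda>x'. G x' w z) (at x) v + frechet_derivative (\<lambda>x'. G x' v z) (at x) w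
       - frechet_derivative (\<lambda>x'. G x' v w) (at x) z) / 2)"

definition curvature ::
    "('e \<Rightarrow> 'e \<Rightarrow> 'e \<Rightarrow> real) \<Rightarrow> 'e \<Rightarrow> 'e \<Rightarrow> 'e \<Rightarrow> 'e \<Rightarrow> 'e::euclidean_space" where
  "curvature G x v w z =
     frechet_derivative (\<lambda>x'. christoffel G x' w z) (at x) v
     - frechet_derivative (\<lambda>x'. christoffel G x' v z) (at x) w
     + christoffel G x v (christoffel G x w z) - christoffel G x w (christoffel G x v z)"

definition sectional_curvature ::
    "('e \<Rightarrow> 'e \<Rightarrow> 'e \<Rightarrow> real) \<Rightarrow> 'e \<Rightarrow> 'e \<Rightarrow> 'e::euclidean_space \<Rightarrow> real" where
  "sectional_curvature G x v w =
     G x (curvature G x v w w) v / (G x v v * G x w w - (G x v w)\<^sup>2)"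

text \<open>The trace with respect to \<open>G\<close> of the covariant Hessian (the non-positive Laplacian).\<close>

definition laplacian ::
    "('e \<Rightarrow> 'e \<Rightarrow> 'e \<Rightarrow> real) \<Rightarrow> ('e \<Rightarrow> real) \<Rightarrow> 'e::euclidean_space \<Rightarrow> real" where
  "laplacian G u x = endo_trace (\<lambda>v. THE y. \<forall>w. G x y w =
     frechet_derivative (\<lambda>x'. frechet_derivative u (at x') w) (at x) v
     - frechet_derivative u (at x) (christoffel G x v w))"

definition constant_sectional_curvature ::
    "('a, 'e::euclidean_space) mfd \<Rightarrow> ('a, 'e) metric \<Rightarrow> real \<Rightarrow> bool" where
  "constant_sectional_curvature M g \<kappa> \<longleftrightarrow>
     (\<forall>c\<in>charts M. \<forall>x\<in>chart_image c. \<forall>v w.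
        g c x v v * g c x w w - (g c x v w)\<^sup>2 \<noteq> 0 \<longrightarrow> sectional_curvature (g c) x v w = \<kappa>)"

definition hyperbolic_metric :: "('a, complex) mfd \<Rightarrow> ('a, complex) metric \<Rightarrow> bool" where
  "hyperbolic_metric S h \<longleftrightarrow> riemannian_metric S h \<and> constant_sectional_curvature S h (-1)"

definition isometric_embedding ::
    "('a, 'e::euclidean_space) mfd \<Rightarrow> ('a, 'e) metric \<Rightarrow>
     ('b, 'f::euclidean_space) mfd \<Rightarrow> ('b, 'f) metric \<Rightarrow> ('a \<Rightarrow> 'b) \<Rightarrow> bool" where
  "isometric_embedding M g N k f \<longleftrightarrow> smooth_embedding M N f \<and>
     (\<forall>c\<in>charts M. \<forall>d\<in>charts N. \<forall>p\<in>fst c \<inter> f -` fst d. \<forall>v w.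
        g c (snd c p) v w =
        k d (snd d (f p)) (frechet_derivative (in_charts c d f) (at (snd c p)) v)
                          (frechet_derivative (in_charts c d f) (at (snd c p)) w))"


section \<open>GHMC anti-de Sitter manifolds\<close>

definition ads_manifold :: "('m, real ^ 3) mfd \<Rightarrow> ('m, real ^ 3) metric \<Rightarrow> bool" where
  "ads_manifold M g \<longleftrightarrow> smooth_manifold M \<and> connected_space (mtop M) \<and>
     lorentzian_metric M g \<and> constant_sectional_curvature M g (-1)"

text \<open>
  Curves are parameterised by the whole real line; every open interval can be reparameterised so,
  and a smooth causal curve having an end point in its domain is extensible.
\<close>

definition inextensible_causal_curve ::
    "('m, real ^ 3) mfd \<Rightarrow> ('m, real ^ 3) metric \<Rightarrow> (real \<Rightarrow> 'm) \<Rightarrow> bool" where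
  "inextensible_causal_curve M g \<gamma> \<longleftrightarrow>
     continuous_map euclideanreal (mtop M) \<gamma> \<and>
     (\<forall>d\<in>charts M. smooth_on (\<gamma> -` fst d) (snd d \<circ> \<gamma>) \<and>
        (\<forall>s\<in>\<gamma> -` fst d. let v = vector_derivative (snd d \<circ> \<gamma>) (at s)
           in v \<noteq> 0 \<and> g d (snd d (\<gamma> s)) v v \<le> 0)) \<and>
     \<not> (\<exists>p. limitin (mtop M) \<gamma> p at_top) \<and> \<not> (\<exists>p. limitin (mtop M) \<gamma> p at_bot)"

definition cauchy_surface ::
    "('m, real ^ 3) mfd \<Rightarrow> ('m, real ^ 3) metric \<Rightarrow> 'm set \<Rightarrow> bool" where
  "cauchy_surface M g \<Sigma> \<longleftrightarrow> \<Sigma> \<subseteq> topspace (mtop M) \<and>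
     (\<exists>N. mtop N = subtopology (mtop M) \<Sigma> \<and> closed_oriented_surface N \<and>
          smooth_embedding N M (\<lambda>p. p)) \<and>
     (\<forall>\<gamma>. inextensible_causal_curve M g \<gamma> \<longrightarrow> (\<exists>!s. \<gamma> s \<in> \<Sigma>))"

text \<open>
  In the maximality condition the competitor \<open>M'\<close> has its points in the same type \<open>'m\<close>. This is no
  restriction: a nonempty three-manifold has exactly continuum many points, so any competitor
  of \<open>M\<close> can be transported to \<open>'m\<close>.
\<close>

definition ghmc_ads :: "('m, real ^ 3) mfd \<Rightarrow> ('m, real ^ 3) metric \<Rightarrow> bool" where
  "ghmc_ads M g \<longleftrightarrow> ads_manifold M g \<and> (\<exists>\<Sigma>. cauchy_surface M g \<Sigma>) \<and>
     (\<forall>(M' :: ('m, real ^ 3) mfd) g' f \<Sigma>.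
        ads_manifold M' g' \<and> isometric_embedding M g M' g' f \<and>
        cauchy_surface M g \<Sigma> \<and> cauchy_surface M' g' (f ` \<Sigma>) \<longrightarrow>
        f ` topspace (mtop M) = topspace (mtop M'))"


section \<open>Space-like surfaces\<close>

text \<open>
  Below, \<open>\<sigma>\<close> is a map from a surface \<open>S\<close> to \<open>M\<close>, expressed in a chart \<open>c\<close> of \<open>S\<close> around \<open>p\<close> and in a
  chart of \<open>M\<close> around \<open>\<sigma> p\<close>; the result depends on \<open>c\<close> only, through the coordinate vectors
  \<open>v\<close>, \<open>w\<close> at \<open>p\<close>.
\<close>

definition push_forward ::
    "('m, real ^ 3) mfd \<Rightarrow> ('s \<Rightarrow> 'm) \<Rightarrow> ('s, complex) chart \<Rightarrow> 's \<Rightarrow> complex \<Rightarrow> real ^ 3" where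
  "push_forward M \<sigma> c p v =
     frechet_derivative (in_charts c (chart_at M (\<sigma> p)) \<sigma>) (at (snd c p)) v"

definition first_form ::
    "('m, real ^ 3) mfd \<Rightarrow> ('m, real ^ 3) metric \<Rightarrow> ('s \<Rightarrow> 'm) \<Rightarrow>
     ('s, complex) chart \<Rightarrow> 's \<Rightarrow> complex \<Rightarrow> complex \<Rightarrow> real" where
  "first_form M g \<sigma> c p v w = (let d = chart_at M (\<sigma> p) in
     g d (snd d (\<sigma> p)) (push_forward M \<sigma> c p v) (push_forward M \<sigma> c p w))"

text \<open>A vector field of \<open>M\<close> along \<open>\<sigma>\<close> is given by its coordinates \<open>\<nu> d p\<close> in each chart \<open>d\<close> around \<open>\<sigma> p\<close>.\<close>

definition unit_normal_field ::
    "('s, complex) mfd \<Rightarrow> ('m, real ^ 3) mfd \<Rightarrow> ('m, real ^ 3) metric \<Rightarrow> ('s \<Rightarrow> 'm) \<Rightarrow>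
     (('m, real ^ 3) chart \<Rightarrow> 's \<Rightarrow> real ^ 3) \<Rightarrow> bool" where
  "unit_normal_field S M g \<sigma> \<nu> \<longleftrightarrow>
     (\<forall>c\<in>charts S. \<forall>d\<in>charts M. smooth_on (snd c ` (fst c \<inter> \<sigma> -` fst d)) (\<nu> d \<circ> chart_inv c)) \<and>
     (\<forall>d\<in>charts M. \<forall>d'\<in>charts M. \<forall>p\<in>topspace (mtop S) \<inter> \<sigma> -` (fst d \<inter> fst d').
        \<nu> d' p = frechet_derivative (transition d d') (at (snd d (\<sigma> p))) (\<nu> d p)) \<and>
     (\<forall>d\<in>charts M. \<forall>p\<in>topspace (mtop S) \<inter> \<sigma> -` fst d. g d (snd d (\<sigma> p)) (\<nu> d p) (\<nu> d p) = -1) \<and>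
     (\<forall>c\<in>charts S. \<forall>d\<in>charts M. \<forall>p\<in>fst c \<inter> \<sigma> -` fst d. \<forall>v.
        g d (snd d (\<sigma> p)) (\<nu> d p)
          (frechet_derivative (in_charts c d \<sigma>) (at (snd c p)) v) = 0)"

text \<open>\<open>II(v, w) = g(\<nabla>\<^sub>v \<nu>, d\<sigma> w)\<close>, and \<open>B\<close> is the operator with \<open>I(B v, w) = II(v, w)\<close>.\<close>

definition second_form ::
    "('m, real ^ 3) mfd \<Rightarrow> ('m, real ^ 3) metric \<Rightarrow> ('s \<Rightarrow> 'm) \<Rightarrow>
     (('m, real ^ 3) chart \<Rightarrow> 's \<Rightarrow> real ^ 3) \<Rightarrow>
     ('s, complex) chart \<Rightarrow> 's \<Rightarrow> complex \<Rightarrow> complex \<Rightarrow> real" where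
  "second_form M g \<sigma> \<nu> c p v w = (let d = chart_at M (\<sigma> p) in
     g d (snd d (\<sigma> p))
       (frechet_derivative (\<nu> d \<circ> chart_inv c) (at (snd c p)) v
         + christoffel (g d) (snd d (\<sigma> p)) (push_forward M \<sigma> c p v) (\<nu> d p))
       (push_forward M \<sigma> c p w))"

definition shape_operator ::
    "('m, real ^ 3) mfd \<Rightarrow> ('m, real ^ 3) metric \<Rightarrow> ('s \<Rightarrow> 'm) \<Rightarrow>
     (('m, real ^ 3) chart \<Rightarrow> 's \<Rightarrow> real ^ 3) \<Rightarrow>
     ('s, complex) chart \<Rightarrow> 's \<Rightarrow> complex \<Rightarrow> complex" where
  "shape_operator M g \<sigma> \<nu> c p v =
     (THE y. \<forall>w. first_form M g \<sigma> c p y w = second_form M g \<sigma> \<nu> c p v w)"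

definition maximal_surface ::
    "('s, complex) mfd \<Rightarrow> ('m, real ^ 3) mfd \<Rightarrow> ('m, real ^ 3) metric \<Rightarrow> ('s \<Rightarrow> 'm) \<Rightarrow>
     (('m, real ^ 3) chart \<Rightarrow> 's \<Rightarrow> real ^ 3) \<Rightarrow> bool" where
  "maximal_surface S M g \<sigma> \<nu> \<longleftrightarrow> smooth_embedding S M \<sigma> \<and>
     (\<forall>c\<in>charts S. \<forall>p\<in>fst c. \<forall>v. v \<noteq> 0 \<longrightarrow> 0 < first_form M g \<sigma> c p v v) \<and>
     unit_normal_field S M g \<sigma> \<nu> \<and>
     (\<forall>c\<in>charts S. \<forall>p\<in>fst c. endo_trace (shape_operator M g \<sigma> \<nu> c p) = 0)"

text \<open>The determinant depends neither on the chart nor on the sign of the normal \<open>\<nu>\<close>.\<close>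

definition principal_curvature ::
    "('s, complex) mfd \<Rightarrow> ('m, real ^ 3) mfd \<Rightarrow> ('m, real ^ 3) metric \<Rightarrow> ('s \<Rightarrow> 'm) \<Rightarrow>
     (('m, real ^ 3) chart \<Rightarrow> 's \<Rightarrow> real ^ 3) \<Rightarrow> 's \<Rightarrow> real" where
  "principal_curvature S M g \<sigma> \<nu> p = sqrt (- endo_det (shape_operator M g \<sigma> \<nu> (chart_at S p) p))"


section \<open>Quadratic differentials and the parameterisation\<close>

text \<open>
  A complex structure compatible with \<open>h\<close> is given by an atlas \<open>J\<close> of conformal coordinates among the
  oriented charts of \<open>S\<close>: in such a chart \<open>h = r |dz|\<^sup>2\<close> with \<open>r > 0\<close>.
\<close>

definition compatible_complex_structure ::
    "('s, complex) mfd \<Rightarrow> ('s, complex) metric \<Rightarrow> ('s, complex) chart set \<Rightarrow> bool" where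
  "compatible_complex_structure S h J \<longleftrightarrow> J \<subseteq> charts S \<and> (\<Union>c\<in>J. fst c) = topspace (mtop S) \<and>
     (\<forall>c\<in>J. \<forall>d\<in>J. transition c d holomorphic_on snd c ` (fst c \<inter> fst d)) \<and>
     (\<forall>c\<in>J. \<forall>x\<in>chart_image c. \<exists>r>0. \<forall>v w. h c x v w = r * (v \<bullet> w))"

text \<open>In the chart \<open>c\<close> with coordinate \<open>z\<close> the quadratic differential is \<open>q c z dz\<^sup>2\<close>.\<close>

type_synonym 's quad_diff = "('s, complex) chart \<Rightarrow> complex \<Rightarrow> complex"

definition holomorphic_quad_diff :: "('s, complex) chart set \<Rightarrow> 's quad_diff \<Rightarrow> bool" where
  "holomorphic_quad_diff J q \<longleftrightarrow> (\<forall>c\<in>J. q c holomorphic_on chart_image c) \<and>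
     (\<forall>c\<in>J. \<forall>d\<in>J. \<forall>p\<in>fst c \<inter> fst d.
        q c (snd c p) = q d (snd d p) * (deriv (transition c d) (snd c p))\<^sup>2)"

definition quad_diff_zeros :: "('s, complex) chart set \<Rightarrow> 's quad_diff \<Rightarrow> 's set" where
  "quad_diff_zeros J q = {p. \<exists>c\<in>J. p \<in> fst c \<and> q c (snd c p) = 0}"

text \<open>In a conformal coordinate \<open>h = e\<^bsup>2v\<^esup> |dz|\<^sup>2\<close>, and \<open>h c x 1 1\<close> is the factor \<open>e\<^bsup>2v\<^esup>\<close>.\<close>

definition quad_diff_norm ::
    "('s, complex) metric \<Rightarrow> 's quad_diff \<Rightarrow> ('s, complex) chart \<Rightarrow> 's \<Rightarrow> real" where
  "quad_diff_norm h q c p = cmod (q c (snd c p)) / h c (snd c p) 1 1"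

text \<open>
  \<open>M\<close> is the GHMC anti-de Sitter manifold parameterised by \<open>(h, q)\<close>, with maximal surface \<open>\<sigma> : S \<rightarrow> M\<close>
  having \<open>I = e\<^bsup>2u\<^esup> h\<close> and \<open>B = I\<^sup>-\<^sup>1 \<Re>(q)\<close>; the last conjunct is \<open>I(B v, w) = \<Re>(q)(v, w)\<close>.
\<close>

definition ghmc_ads_parameterised_by ::
    "('s, complex) mfd \<Rightarrow> ('s, complex) metric \<Rightarrow> ('s, complex) chart set \<Rightarrow> 's quad_diff \<Rightarrow>
     ('m, real ^ 3) mfd \<Rightarrow> ('m, real ^ 3) metric \<Rightarrow> ('s \<Rightarrow> 'm) \<Rightarrow>
     (('m, real ^ 3) chart \<Rightarrow> 's \<Rightarrow> real ^ 3) \<Rightarrow> bool" where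
  "ghmc_ads_parameterised_by S h J q M g \<sigma> \<nu> \<longleftrightarrow>
     ghmc_ads M g \<and> maximal_surface S M g \<sigma> \<nu> \<and>
     (\<exists>u. (\<forall>c\<in>charts S. smooth_on (chart_image c) (u \<circ> chart_inv c)) \<and>
          (\<forall>c\<in>J. \<forall>p\<in>fst c. laplacian (h c) (u \<circ> chart_inv c) (snd c p) =
             exp (2 * u p) - exp (- 2 * u p) * (quad_diff_norm h q c p)\<^sup>2 - 1) \<and>
          (\<forall>c\<in>charts S. \<forall>p\<in>fst c. \<forall>v w.
             first_form M g \<sigma> c p v w = exp (2 * u p) * h c (snd c p) v w) \<and>
          (\<forall>c\<in>J. \<forall>p\<in>fst c. \<forall>v w.
             first_form M g \<sigma> c p (shape_operator M g \<sigma> \<nu> c p v) w = Re (q c (snd c p) * v * w)))"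

end

theory Submission
  imports Defs
begin

text \<open>
  Put \<open>\<lambda> = t \<parallel>q\<parallel> e\<^bsup>-2u\<^esup>\<close>. The equation for \<open>u\<close> becomes \<open>\<Delta>\<^sub>h u = e\<^bsup>2u\<^esup> (1 - \<lambda>\<^sup>2) - 1\<close>, and since \<open>h\<close>
  has curvature \<open>-1\<close>, \<open>\<Delta>\<^sub>h ln \<parallel>q\<parallel> = -2\<close> off the zeros of \<open>q\<close>. Everything follows from the second
  derivative test. At a maximum of \<open>\<parallel>q\<parallel> e\<^bsup>-au\<^esup>\<close> one gets \<open>e\<^bsup>2u\<^esup> (1 - \<lambda>\<^sup>2) \<ge> 1 - 2/a\<close>; \<open>a = 2\<close> yields
  \<open>\<lambda> \<le> 1\<close> everywhere, and \<open>a\<close> slightly above \<open>2\<close> yields \<open>\<lambda> < 1\<close>. At a maximum of \<open>u\<^sub>t - u\<^sub>s\<close>, \<open>s < t\<close>,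
  this strictness gives \<open>u\<^sub>t - (ln t)/2 < u\<^sub>s - (ln s)/2\<close>, which is the monotonicity of \<open>\<lambda>\<close>. Finally,
  on a disc without zeros \<open>(ln \<parallel>q\<parallel>)/2 + \<kappa> + K |z - z0|\<^sup>2\<close> is an upper barrier for \<open>u\<^sub>t - (ln t)/2\<close> for all
  large \<open>t\<close>, whence \<open>liminf \<lambda> \<ge> e\<^bsup>-2\<kappa>\<^esup>\<close> at its centre.
\<close>

section \<open>The flat Laplacian\<close>

lemma smooth_onD:
  assumes "smooth_on U f" "x \<in> U"
  shows "f differentiable (at x)"
  using assms by (auto elim: smooth_on.cases)

lemma smooth_on_frechet_derivative:
  assumes "smooth_on U f"
  shows "smooth_on U (\<lambda>x. frechet_derivative f (at x) v)"
  using assms by (auto elim: smooth_on.cases)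

definition has_laplacian :: "(complex \<Rightarrow> real) \<Rightarrow> real \<Rightarrow> complex \<Rightarrow> bool" where
  "has_laplacian f L x \<longleftrightarrow> (\<exists>D H. (\<forall>\<^sub>F y in nhds x. (f has_derivative D y) (at y)) \<and>
     (\<forall>v. ((\<lambda>y. D y v) has_derivative H v) (at x)) \<and> L = H 1 1 + H \<i> \<i>)"

lemma has_laplacianI:
  assumes "\<forall>\<^sub>F y in nhds x. (f has_derivative D y) (at y)"
    and "\<And>v. ((\<lambda>y. D y v) has_derivative H v) (at x)"
    and "H 1 1 + H \<i> \<i> = L"
  shows "has_laplacian f L x"
  unfolding has_laplacian_def using assms by blast

lemma has_laplacian_add:
  assumes "has_laplacian f L x" "has_laplacian f' L' x"
  shows "has_laplacian (\<lambda>y. f y + f' y) (L + L') x"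
proof -
  obtain D H where 1: "\<forall>\<^sub>F y in nhds x. (f has_derivative D y) (at y)"
    "\<And>v. ((\<lambda>y. D y v) has_derivative H v) (at x)" "L = H 1 1 + H \<i> \<i>"
    using assms(1) unfolding has_laplacian_def by blast
  obtain D' H' where 2: "\<forall>\<^sub>F y in nhds x. (f' has_derivative D' y) (at y)"
    "\<And>v. ((\<lambda>y. D' y v) has_derivative H' v) (at x)" "L' = H' 1 1 + H' \<i> \<i>"
    using assms(2) unfolding has_laplacian_def by blast
  show ?thesis 
  proof (rule has_laplacianI[where D = "\<lambda>y v. D y v + D' y v" and
      H = "\<lambda>v w. H v w + H' v w"])
    show "\<forall>\<^sub>F y in nhds x. ((\<lambda>y. f y + f' y) has_derivative (\<lambda>v. D y v + D' y v)) (at y)"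
      using 1(1) 2(1) by eventually_elim (rule has_derivative_add)
    show "((\<lambda>y. D y v + D' y v) has_derivative (\<lambda>w. H v w + H' v w)) (at x)" for v
      by (intro has_derivative_add 1 2)
  qed (use 1 2 in simp)
qed

lemma has_laplacian_cmult:
  assumes "has_laplacian f L x"
  shows "has_laplacian (\<lambda>y. a * f y) (a * L) x"
proof -
  obtain D H where 1: "\<forall>\<^sub>F y in nhds x. (f has_derivative D y) (at y)"
    "\<And>v. ((\<lambda>y. D y v) has_derivative H v) (at x)" "L = H 1 1 + H \<i> \<i>"
    using assms(1) unfolding has_laplacian_def by blast
  show ?thesis 
  proof (rule has_laplacianI[where D = "\<lambda>y v. a * D y v" and
      H = "\<lambda>v w. a * H v w"])
    show "\<forall>\<^sub>F y in nhds x. ((\<lambda>y. a * f y) has_derivative (\<lambda>v. a * D y v)) (at y)"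
      using 1(1) by eventually_elim (intro has_derivative_mult_right)
    show "((\<lambda>y. a * D y v) has_derivative (\<lambda>w. a * H v w)) (at x)" for v
      by (intro has_derivative_mult_right 1)
  qed (use 1 in \<open>simp add: algebra_simps\<close>)
qed

lemma has_laplacian_norm_square: "has_laplacian (\<lambda>y. (cmod (y - a))\<^sup>2) 4 x"
proof -
  have *: "(\<lambda>y. (cmod (y - a))\<^sup>2) = (\<lambda>y. (Re y - Re a)\<^sup>2 + (Im y - Im a)\<^sup>2)"
    by (simp add: cmod_power2)
  show ?thesis unfolding *
  proof (rule has_laplacianI[where D = "\<lambda>y v. 2 * (Re y - Re a) * Re v + 2 * (Im y - Im a) * Im v" and
      H = "\<lambda>v w. 2 * Re w * Re v + 2 * Im w * Im v"])
    have "((\<lambda>y. (Re y - Re a)\<^sup>2 + (Im y - Im a)\<^sup>2) has_derivative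
       (\<lambda>v. 2 * (Re y - Re a) * Re v + 2 * (Im y - Im a) * Im v)) (at y)" for y
      by (auto intro!: derivative_eq_intros simp: fun_eq_iff algebra_simps)
    then show "\<forall>\<^sub>F y in nhds x. ((\<lambda>y. (Re y - Re a)\<^sup>2 + (Im y - Im a)\<^sup>2) has_derivative
       (\<lambda>v. 2 * (Re y - Re a) * Re v + 2 * (Im y - Im a) * Im v)) (at y)"
      by simp
    show "((\<lambda>y. 2 * (Re y - Re a) * Re v + 2 * (Im y - Im a) * Im v) has_derivative
       (\<lambda>w. 2 * Re w * Re v + 2 * Im w * Im v)) (at x)" for v
      by (auto intro!: derivative_eq_intros)
  qed simp
qed

lemma open_holomorphic_nonzero:
  assumes "f holomorphic_on U" "open U"
  shows "open {y \<in> U. f y \<noteq> 0}"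
  using continuous_open_preimage[OF holomorphic_on_imp_continuous_on[OF assms(1)] assms(2),
      of "- {0}"]
  by (auto simp: vimage_def Int_def)

lemma has_laplacian_ln_norm_holomorphic:
  assumes "f holomorphic_on U" "open U" "x \<in> U" "f x \<noteq> 0"
  shows "has_laplacian (\<lambda>y. ln (cmod (f y))) 0 x"
proof -
  define V where "V = {y \<in> U. f y \<noteq> 0}"
  have V: "open V" "x \<in> V" "V \<subseteq> U" "\<And>y. y \<in> V \<Longrightarrow> f y \<noteq> 0"
    using open_holomorphic_nonzero[OF assms(1,2)] assms by (auto simp: V_def)
  define l where "l = (\<lambda>y. deriv f y / f y)"
  have fV: "f holomorphic_on V"
    using assms(1) V(3) holomorphic_on_subset by blast
  have l: "l holomorphic_on V"
    unfolding l_def using V fV by (intro holomorphic_intros holomorphic_deriv) auto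
  show ?thesis 
  proof (rule has_laplacianI[where D = "\<lambda>y v. Re (l y * v)" and
      H = "\<lambda>v w. Re (deriv l x * w * v)"])
    have "((\<lambda>y. ln (cmod (f y))) has_derivative (\<lambda>v. Re (l y * v))) (at y)" if "y \<in> V" for y
    proof -
      have "(f has_field_derivative deriv f y) (at y)"
        using fV V(1) that holomorphic_derivI by blast
      then have d: "(f has_derivative (\<lambda>v. deriv f y * v)) (at y)"
        by (simp add: has_field_derivative_def)
      have "((\<lambda>y. ln (cmod (f y))) has_derivative
          (\<lambda>v. (deriv f y * v) \<bullet> sgn (f y) / cmod (f y))) (at y)"
        using V(4)[OF that] has_derivative_compose[OF d has_derivative_norm[of "f y"]]
        by (auto intro!: derivative_eq_intros simp: divide_simps)
      moreover have "(deriv f y * v) \<bullet> sgn (f y) / cmod (f y) = Re (l y * v)" for v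
      proof -
        have "l y = (deriv f y * cnj (f y)) / (of_real ((cmod (f y))\<^sup>2))"
          unfolding l_def using V(4)[OF that]
          by (subst complex_norm_square) (simp add: field_simps)
        then have "l y * v = (deriv f y * v * cnj (f y)) / of_real ((cmod (f y))\<^sup>2)"
          by simp
        then have "Re (l y * v) = Re (deriv f y * v * cnj (f y)) / (cmod (f y))\<^sup>2"
          by (metis Re_divide_of_real)
        then show ?thesis
          by (simp add: sgn_div_norm power2_eq_square divide_inverse)
            (simp add: inner_complex_def algebra_simps)
      qed
      ultimately show ?thesis by simp
    qed
    then show "\<forall>\<^sub>F y in nhds x. ((\<lambda>y. ln (cmod (f y))) has_derivative (\<lambda>v. Re (l y * v))) (at y)"
      using V(1,2) eventually_nhds by blast
    have "(l has_field_derivative deriv l x) (at x)"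
      using l V(1,2) holomorphic_derivI by blast
    then have d: "(l has_derivative (\<lambda>v. deriv l x * v)) (at x)"
      by (simp add: has_field_derivative_def)
    show "((\<lambda>y. Re (l y * v)) has_derivative (\<lambda>w. Re (deriv l x * w * v))) (at x)" for v
      by (intro has_derivative_Re has_derivative_mult_left d)
  qed simp
qed

lemma second_derivative_nonpos_at_local_max:
  fixes \<phi> \<phi>' :: "real \<Rightarrow> real"
  assumes d: "\<forall>\<^sub>F s in nhds 0. (\<phi> has_real_derivative \<phi>' s) (at s)"
    and d2: "(\<phi>' has_real_derivative l) (at 0)"
    and mx: "\<forall>\<^sub>F s in nhds 0. \<phi> s \<le> \<phi> 0"
  shows "l \<le> 0"
proof (rule ccontr)
  assume "\<not> l \<le> 0"
  then have "l > 0" by simp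
  obtain \<delta> where \<delta>: "\<delta> > 0" "\<And>s. \<bar>s\<bar> < \<delta> \<Longrightarrow> (\<phi> has_real_derivative \<phi>' s) (at s) \<and> \<phi> s \<le> \<phi> 0"
    using eventually_conj[OF d mx] unfolding eventually_nhds_metric dist_real_def by auto
  have "\<phi>' 0 = 0"
    by (rule DERIV_local_max[of \<phi> "\<phi>' 0" 0 \<delta>]) (use \<delta> in auto)
  then obtain \<epsilon> where \<epsilon>: "\<epsilon> > 0" "\<And>h. 0 < h \<Longrightarrow> h < \<epsilon> \<Longrightarrow> 0 < \<phi>' h"
    using DERIV_pos_inc_right[OF d2 \<open>l > 0\<close>] by auto
  define b where "b = min \<delta> \<epsilon> / 2"
  have b: "b > 0" "b < \<delta>" "b < \<epsilon>" using \<delta> \<epsilon> by (auto simp: b_def)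
  obtain z where "0 < z" "z < b" "\<phi> b - \<phi> 0 = (b - 0) * \<phi>' z"
    using MVT2[of 0 b \<phi> \<phi>'] b \<delta> by force
  moreover have "\<phi>' z > 0" using \<epsilon> b calculation by auto
  ultimately have "\<phi> b > \<phi> 0"
    using b(1) by (metis diff_gt_0_iff_gt diff_zero mult_pos_pos)
  then show False using \<delta>(2)[of b] b by auto
qed

lemma has_laplacian_nonpos_at_local_max:
  assumes "has_laplacian f L x" "\<forall>\<^sub>F y in nhds x. f y \<le> f x"
  shows "L \<le> 0"
proof -
  obtain D H where 1: "\<forall>\<^sub>F y in nhds x. (f has_derivative D y) (at y)"
    "\<And>v. ((\<lambda>y. D y v) has_derivative H v) (at x)" "L = H 1 1 + H \<i> \<i>"
    using assms(1) unfolding has_laplacian_def by blast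
  have "H v v \<le> 0" for v
  proof (rule second_derivative_nonpos_at_local_max)
    let ?\<gamma> = "\<lambda>s. x + of_real s * v"
    have lim: "filterlim ?\<gamma> (nhds x) (nhds 0)"
    proof -
      have "isCont ?\<gamma> 0" by (intro continuous_intros)
      then show ?thesis using tendsto_at_iff_tendsto_nhds[of ?\<gamma> 0] by (simp add: isCont_def)
    qed
    have \<gamma>: "(?\<gamma> has_derivative (\<lambda>h. of_real h * v)) (at s)" for s
      by (auto intro!: derivative_eq_intros)
    show "\<forall>\<^sub>F s in nhds 0. ((\<lambda>s. f (?\<gamma> s)) has_real_derivative D (?\<gamma> s) v) (at s)"
      using eventually_compose_filterlim[OF 1(1) lim]
    proof eventually_elim
      case (elim s)
      have "((\<lambda>s. f (?\<gamma> s)) has_derivative (\<lambda>h. D (?\<gamma> s) (of_real h * v))) (at s)"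
        by (rule has_derivative_compose[OF \<gamma> elim])
      moreover have "D (?\<gamma> s) (of_real h * v) = D (?\<gamma> s) v * h" for h
        using linear_cmul[OF has_derivative_linear[OF elim], of h v] by (simp add: scaleR_conv_of_real)
      ultimately show ?case by (simp add: has_field_derivative_def)
    qed
    have "((\<lambda>s. D (?\<gamma> s) v) has_derivative (\<lambda>h. H v (of_real h * v))) (at 0)"
      by (rule has_derivative_compose[OF \<gamma>]) (use 1(2) in simp)
    moreover have "H v (of_real h * v) = H v v * h" for h
      using linear_cmul[OF has_derivative_linear[OF 1(2)[of v]], of h v]
      by (simp add: scaleR_conv_of_real)
    ultimately show "((\<lambda>s. D (?\<gamma> s) v) has_real_derivative H v v) (at 0)"
      by (simp add: has_field_derivative_def)
    show "\<forall>\<^sub>F s in nhds 0. f (?\<gamma> s) \<le> f (?\<gamma> 0)"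
      using eventually_compose_filterlim[OF assms(2) lim] by simp
  qed
  then show ?thesis using 1(3) by (simp add: add_nonpos_nonpos)
qed

lemma has_laplacian_smooth:
  assumes "smooth_on U f" "open U" "x \<in> U"
  shows "has_laplacian f (frechet_derivative (\<lambda>y. frechet_derivative f (at y) 1) (at x) 1 +
    frechet_derivative (\<lambda>y. frechet_derivative f (at y) \<i>) (at x) \<i>) x"
  
proof (rule has_laplacianI[where D = "\<lambda>y. frechet_derivative f (at y)" and
    H = "\<lambda>v. frechet_derivative (\<lambda>y. frechet_derivative f (at y) v) (at x)"])
  have "\<forall>y\<in>U. (f has_derivative frechet_derivative f (at y)) (at y)"
    using smooth_onD[OF assms(1)] frechet_derivative_works by blast
  then show "\<forall>\<^sub>F y in nhds x. (f has_derivative frechet_derivative f (at y)) (at y)"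
    using assms(2,3) eventually_nhds by blast
  show "((\<lambda>y. frechet_derivative f (at y) v) has_derivative
     frechet_derivative (\<lambda>y. frechet_derivative f (at y) v) (at x)) (at x)" for v
    using smooth_onD[OF smooth_on_frechet_derivative[OF assms(1)] assms(3)]
      frechet_derivative_works by blast
qed (rule refl)

section \<open>Conformal metrics\<close>

lemma complex_linear_expand:
  fixes f :: "complex \<Rightarrow> 'b::real_vector"
  assumes "linear f"
  shows "f z = Re z *\<^sub>R f 1 + Im z *\<^sub>R f \<i>"
proof -
  have "f z = f (Re z *\<^sub>R 1 + Im z *\<^sub>R \<i>)"
    by (rule arg_cong[of _ _ f]) (simp add: complex_eq_iff)
  then show ?thesis using assms by (simp add: linear_add linear_cmul)
qed

lemma linear_from_complex_expand:
  fixes f :: "complex \<Rightarrow> real"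
  assumes "\<And>w. f w = Re w * f 1 + Im w * f \<i>"
  shows "linear f"
proof (rule linearI)
  show "f (x + y) = f x + f y" for x y
    unfolding assms[of "x + y"] assms[of x] assms[of y] by (simp add: algebra_simps)
  show "f (c *\<^sub>R x) = c *\<^sub>R f x" for c x
    unfolding assms[of "c *\<^sub>R x"] assms[of x] by (simp add: algebra_simps)
qed

locale conformal_metric =
  fixes U :: "complex set" and G :: "complex \<Rightarrow> complex \<Rightarrow> complex \<Rightarrow> real"
    and r :: "complex \<Rightarrow> real"
  assumes U: "open U"
    and G: "\<And>x v w. x \<in> U \<Longrightarrow> G x v w = r x * (v \<bullet> w)"
    and r_pos: "\<And>x. x \<in> U \<Longrightarrow> r x > 0"
    and r_smooth: "smooth_on U r"
begin

abbreviation "dr x v \<equiv> frechet_derivative r (at x) v"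

lemma r_deriv: "x \<in> U \<Longrightarrow> (r has_derivative frechet_derivative r (at x)) (at x)"
  using smooth_onD[OF r_smooth] frechet_derivative_works by blast

lemma dr_deriv:
  "x \<in> U \<Longrightarrow> ((\<lambda>x. dr x v) has_derivative frechet_derivative (\<lambda>x. dr x v) (at x)) (at x)"
  using smooth_onD[OF smooth_on_frechet_derivative[OF r_smooth]] frechet_derivative_works by blast

lemma frechet_derivative_G:
  assumes "x \<in> U"
  shows "frechet_derivative (\<lambda>x. G x w z) (at x) v = dr x v * (w \<bullet> z)"
proof -
  have "((\<lambda>x. G x w z) has_derivative (\<lambda>v. dr x v * (w \<bullet> z))) (at x)"
    by (rule has_derivative_transform_within_open[OF _ U assms, of "\<lambda>x. r x * (w \<bullet> z)"])
      (auto intro!: derivative_eq_intros r_deriv[OF assms] simp: G)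
  from frechet_derivative_at[OF this, symmetric] show ?thesis by simp
qed

lemma THE_represent:
  assumes "x \<in> U" "linear \<Lambda>"
  shows "(THE y. \<forall>z. G x y z = \<Lambda> z) = Complex (\<Lambda> 1 / r x) (\<Lambda> \<i> / r x)"
proof (rule the_equality)
  have "r x \<noteq> 0" using r_pos[OF assms(1)] by simp
  then show "\<forall>z. G x (Complex (\<Lambda> 1 / r x) (\<Lambda> \<i> / r x)) z = \<Lambda> z"
    by (subst complex_linear_expand[OF assms(2)])
      (auto simp: G[OF assms(1)] inner_complex_def field_simps)
  fix y assume "\<forall>z. G x y z = \<Lambda> z"
  from this[rule_format, of 1] this[rule_format, of \<i>]
  show "y = Complex (\<Lambda> 1 / r x) (\<Lambda> \<i> / r x)"
    using \<open>r x \<noteq> 0\<close> by (auto simp: G[OF assms(1)] inner_complex_def complex_eq_iff field_simps)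
qed

lemma christoffel_conformal:
  assumes "x \<in> U"
  shows "christoffel G x v w =
    Complex ((dr x v * Re w + dr x w * Re v - (v \<bullet> w) * dr x 1) / (2 * r x))
            ((dr x v * Im w + dr x w * Im v - (v \<bullet> w) * dr x \<i>) / (2 * r x))"
proof -
  have "linear (\<lambda>z. (dr x v * (w \<bullet> z) + dr x w * (v \<bullet> z) - dr x z * (v \<bullet> w)) / 2)"
    using has_derivative_linear[OF r_deriv[OF assms]]
    by (auto intro!: linearI simp: linear_add linear_cmul inner_add_right algebra_simps
        add_divide_distrib diff_divide_distrib)
  from THE_represent[OF assms this] show ?thesis
    unfolding christoffel_def frechet_derivative_G[OF assms]
    by (simp add: inner_complex_def mult.commute)
qed

lemma laplacian_conformal:
  assumes "smooth_on U f" "x \<in> U"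
  shows "has_laplacian f (r x * laplacian G f x) x"
proof -
  have df: "y \<in> U \<Longrightarrow> (f has_derivative frechet_derivative f (at y)) (at y)" for y
    using smooth_onD[OF assms(1)] frechet_derivative_works by blast
  have ddf: "((\<lambda>x. frechet_derivative f (at x) v) has_derivative
      frechet_derivative (\<lambda>x. frechet_derivative f (at x) v) (at x)) (at x)" for v
    using smooth_onD[OF smooth_on_frechet_derivative[OF assms(1)]] assms(2)
      frechet_derivative_works by blast
  let ?H = "\<lambda>v w. frechet_derivative (\<lambda>x'. frechet_derivative f (at x') w) (at x) v"
  have H: "?H v w = Re w * ?H v 1 + Im w * ?H v \<i>" for v w
  proof -
    have "((\<lambda>y. frechet_derivative f (at y) w) has_derivative
       (\<lambda>v. Re w * ?H v 1 + Im w * ?H v \<i>)) (at x)"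
    proof (rule has_derivative_transform_within_open[OF _ U assms(2)])
      show "((\<lambda>y. Re w * frechet_derivative f (at y) 1 + Im w * frechet_derivative f (at y) \<i>)
        has_derivative (\<lambda>v. Re w * ?H v 1 + Im w * ?H v \<i>)) (at x)"
        by (auto intro!: derivative_eq_intros ddf)
      show "Re w * frechet_derivative f (at y) 1 + Im w * frechet_derivative f (at y) \<i> =
        frechet_derivative f (at y) w" if "y \<in> U" for y
        using complex_linear_expand[OF has_derivative_linear[OF df[OF that]], of w] by simp
    qed
    from frechet_derivative_at[OF this, symmetric] show ?thesis by simp
  qed
  have r0: "r x \<noteq> 0" using r_pos[OF assms(2)] by simp
  have lin_H: "linear (?H v)" for v
    by (rule linear_from_complex_expand) (rule H)
  have lin_christoffel: "linear (christoffel G x v)" for v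
    using r0 by (intro linearI) (simp_all add: christoffel_conformal[OF assms(2)] complex_eq_iff
        linear_add[OF has_derivative_linear[OF r_deriv[OF assms(2)]]]
        linear_cmul[OF has_derivative_linear[OF r_deriv[OF assms(2)]]] inner_complex_def field_simps)
  have lin': "linear (\<lambda>w. ?H v w - frechet_derivative f (at x) (christoffel G x v w))" for v
    using linear_compose_sub[OF lin_H
        linear_compose[OF lin_christoffel has_derivative_linear[OF df[OF assms(2)]]]]
    by (simp add: o_def)
  have "r x * laplacian G f x = ?H 1 1 + ?H \<i> \<i>"
  proof -
    have "r x * laplacian G f x =
        (?H 1 1 - frechet_derivative f (at x) (christoffel G x 1 1)) +
        (?H \<i> \<i> - frechet_derivative f (at x) (christoffel G x \<i> \<i>))"
      unfolding laplacian_def endo_trace_def THE_represent[OF assms(2) lin'] Basis_complex_def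
      using r0 by (simp add: inner_complex_def distrib_left)
    moreover have "christoffel G x 1 1 + christoffel G x \<i> \<i> = 0"
      using r0 by (simp add: christoffel_conformal[OF assms(2)] inner_complex_def complex_eq_iff)
    ultimately show ?thesis
      using linear_add[OF has_derivative_linear[OF df[OF assms(2)]],
          of "christoffel G x 1 1" "christoffel G x \<i> \<i>"]
        linear_0[OF has_derivative_linear[OF df[OF assms(2)]]]
      by simp
  qed
  then show ?thesis using has_laplacian_smooth[OF assms(1) U assms(2)] by simp
qed

lemma has_laplacian_ln_conformal_factor:
  assumes "x \<in> U" "sectional_curvature G x 1 \<i> = -1"
  shows "has_laplacian (\<lambda>y. ln (r y)) (2 * r x) x"
proof -
  define l where "l = (\<lambda>v y. dr y v / r y)"
  define H where "H = (\<lambda>v. frechet_derivative (l v) (at x))"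
  have r0: "y \<in> U \<Longrightarrow> r y \<noteq> 0" for y using r_pos[of y] by simp
  have H: "(l v has_derivative H v) (at x)" for v
  proof -
    have "l v differentiable (at x)"
      unfolding l_def using dr_deriv[OF assms(1)] r_deriv[OF assms(1)] r0[OF assms(1)]
      by (intro differentiable_divide) (auto simp: differentiable_def)
    then show ?thesis unfolding H_def using frechet_derivative_works by blast
  qed
  have dr: "dr y v = r y * (Re v * l 1 y + Im v * l \<i> y)" if "y \<in> U" for y v
    using r0[OF that] complex_linear_expand[OF has_derivative_linear[OF r_deriv[OF that]], of v]
    by (simp add: l_def field_simps)
  have \<Gamma>: "christoffel G y v w =
      Complex ((Re v * Re w - Im v * Im w) * l 1 y / 2 + (Re v * Im w + Im v * Re w) * l \<i> y / 2)
        ((Re v * Im w + Im v * Re w) * l 1 y / 2 - (Re v * Re w - Im v * Im w) * l \<i> y / 2)"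
    if "y \<in> U" for y v w
    unfolding christoffel_conformal[OF that] dr[OF that, of v] dr[OF that, of w]
      dr[OF that, of 1] dr[OF that, of \<i>]
    using r0[OF that] by (simp add: inner_complex_def complex_eq_iff field_simps)
  have d\<Gamma>: "Re (frechet_derivative (\<lambda>y. christoffel G y v w) (at x) z) =
      (Re v * Re w - Im v * Im w) * H 1 z / 2 + (Re v * Im w + Im v * Re w) * H \<i> z / 2" for v w z
  proof -
    let ?p = "(Re v * Re w - Im v * Im w) / 2" and ?q = "(Re v * Im w + Im v * Re w) / 2"
    have "((\<lambda>y. christoffel G y v w) has_derivative
        (\<lambda>z. of_real (?p * H 1 z + ?q * H \<i> z) + \<i> * of_real (?q * H 1 z - ?p * H \<i> z))) (at x)"
    proof (rule has_derivative_transform_within_open[OF _ U assms(1)])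
      show "((\<lambda>y. of_real (?p * l 1 y + ?q * l \<i> y) + \<i> * of_real (?q * l 1 y - ?p * l \<i> y))
        has_derivative
        (\<lambda>z. of_real (?p * H 1 z + ?q * H \<i> z) + \<i> * of_real (?q * H 1 z - ?p * H \<i> z))) (at x)"
        by (intro derivative_intros H)
    qed (simp add: \<Gamma> complex_eq_iff)
    from frechet_derivative_at[OF this, symmetric] show ?thesis by simp
  qed
  have "Re (curvature G x 1 \<i> \<i>) = - (H 1 1 + H \<i> \<i>) / 2"
    unfolding curvature_def by (simp add: d\<Gamma> \<Gamma>[OF assms(1)] algebra_simps)
  moreover have "r x * Re (curvature G x 1 \<i> \<i>) / (r x * r x) = -1"
    using assms(2) by (simp add: sectional_curvature_def G[OF assms(1)] inner_complex_def)
  ultimately have L: "H 1 1 + H \<i> \<i> = 2 * r x"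
    using r0[OF assms(1)] by (simp add: field_simps)
  show ?thesis
  proof (rule has_laplacianI[where D = "\<lambda>y v. l v y" and H = H])
    have "((\<lambda>y. ln (r y)) has_derivative (\<lambda>v. l v y)) (at y)" if "y \<in> U" for y
      unfolding l_def using r_pos[OF that]
      by (auto intro!: derivative_eq_intros r_deriv[OF that] simp: field_simps)
    then show "\<forall>\<^sub>F y in nhds x. ((\<lambda>y. ln (r y)) has_derivative (\<lambda>v. l v y)) (at y)"
      using U assms(1) eventually_nhds by blast
  qed (use H L in auto)
qed

end

section \<open>The curvature equation on a compact surface\<close>

lemma chart_inv_in:
  assumes "z \<in> chart_image c"
  shows "chart_inv c z \<in> fst c" "snd c (chart_inv c z) = z"
  using assms unfolding chart_image_def chart_inv_def by (auto intro: inv_into_into f_inv_into_f)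

lemma chart_inv_coordinate:
  assumes "is_chart X c" "p \<in> fst c"
  shows "chart_inv c (snd c p) = p"
proof -
  have "fst c \<subseteq> topspace X" using assms openin_subset unfolding is_chart_def by blast
  then have "inj_on (snd c) (fst c)"
    using assms(1) homeomorphic_imp_injective_map[of "subtopology X (fst c)" _ "snd c"]
    unfolding is_chart_def by (auto simp: Int_absorb1)
  then show ?thesis using assms(2) by (simp add: chart_inv_def)
qed

lemma continuous_map_from_charts:
  fixes f :: "'a \<Rightarrow> real" and X :: "'a topology"
  assumes "\<And>p. p \<in> topspace X \<Longrightarrow> \<exists>c :: ('a, 'e::euclidean_space) chart.
    p \<in> fst c \<and> is_chart X c \<and> continuous_on (chart_image c) (f \<circ> chart_inv c)"
  shows "continuous_map X euclideanreal f"
proof -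
  have "\<exists>V. openin X V \<and> p \<in> V \<and> continuous_map (subtopology X V) euclideanreal f"
    if p: "p \<in> topspace X" for p
  proof -
    obtain c :: "('a, 'e) chart" where c: "p \<in> fst c" "is_chart X c"
        "continuous_on (chart_image c) (f \<circ> chart_inv c)"
      using assms[OF p] by blast
    have "continuous_map (subtopology X (fst c)) (top_of_set (chart_image c)) (snd c)"
      using c(2) homeomorphic_imp_continuous_map unfolding is_chart_def by blast
    moreover have "continuous_map (top_of_set (chart_image c)) euclideanreal (f \<circ> chart_inv c)"
      using c(3) by simp
    ultimately have "continuous_map (subtopology X (fst c)) euclideanreal ((f \<circ> chart_inv c) \<circ> snd c)"
      by (rule continuous_map_compose)
    then have "continuous_map (subtopology X (fst c)) euclideanreal f"
      by (rule continuous_map_eq) (use chart_inv_coordinate[OF c(2)] in auto)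
    then show ?thesis using c unfolding is_chart_def by blast
  qed
  then obtain V where V: "\<And>p. p \<in> topspace X \<Longrightarrow>
      openin X (V p) \<and> p \<in> V p \<and> continuous_map (subtopology X (V p)) euclideanreal f"
    by metis
  show ?thesis
    by (rule pasting_lemma[where I = "topspace X" and T = V and f = "\<lambda>_. f"]) (use V in auto)
qed

lemma continuous_attains_max:
  assumes "compact_space X" "topspace X \<noteq> {}" "continuous_map X euclideanreal f"
  obtains p where "p \<in> topspace X" "\<And>q. q \<in> topspace X \<Longrightarrow> f q \<le> (f p :: real)"
proof -
  have "compact (f ` topspace X)"
    using image_compactin[OF _ assms(3), of "topspace X"] assms(1) by (simp add: compact_space_def)
  then show ?thesis
    using compact_attains_sup[of "f ` topspace X"] assms(2) that by auto
qed

locale quad_diff_surface =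
  fixes X :: "'s topology" and J :: "('s, complex) chart set"
    and r :: "('s, complex) chart \<Rightarrow> complex \<Rightarrow> real"
    and f :: "('s, complex) chart \<Rightarrow> complex \<Rightarrow> complex" and N :: "'s \<Rightarrow> real"
    and u :: "real \<Rightarrow> 's \<Rightarrow> real"
  assumes compact: "compact_space X"
    and cover: "\<And>p. p \<in> topspace X \<Longrightarrow> \<exists>c\<in>J. p \<in> fst c"
    and chart: "\<And>c. c \<in> J \<Longrightarrow> is_chart X c"
    and r_pos: "\<And>c z. c \<in> J \<Longrightarrow> z \<in> chart_image c \<Longrightarrow> r c z > 0"
    and r_continuous: "\<And>c. c \<in> J \<Longrightarrow> continuous_on (chart_image c) (r c)"
    and laplacian_ln_r: "\<And>c z. c \<in> J \<Longrightarrow> z \<in> chart_image c \<Longrightarrow>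
          has_laplacian (\<lambda>z. ln (r c z)) (2 * r c z) z"
    and f_holomorphic: "\<And>c. c \<in> J \<Longrightarrow> f c holomorphic_on chart_image c"
    and N: "\<And>c p. c \<in> J \<Longrightarrow> p \<in> fst c \<Longrightarrow> N p = cmod (f c (snd c p)) / r c (snd c p)"
    and f_nonzero: "\<exists>c\<in>J. \<exists>z\<in>chart_image c. f c z \<noteq> 0"
    and u_continuous: "\<And>t c. t > 0 \<Longrightarrow> c \<in> J \<Longrightarrow> continuous_on (chart_image c) (u t \<circ> chart_inv c)"
    and laplacian_u: "\<And>t c p. t > 0 \<Longrightarrow> c \<in> J \<Longrightarrow> p \<in> fst c \<Longrightarrow>
          has_laplacian (u t \<circ> chart_inv c)
            (r c (snd c p) * (exp (2 * u t p) - exp (- 2 * u t p) * (t * N p)\<^sup>2 - 1)) (snd c p)"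
begin

definition lam :: "real \<Rightarrow> 's \<Rightarrow> real" where
  "lam t p = t * N p * exp (- 2 * u t p)"

lemma chart_subset: "c \<in> J \<Longrightarrow> fst c \<subseteq> topspace X"
  using chart openin_subset unfolding is_chart_def by blast

lemma coordinate_in: "p \<in> fst c \<Longrightarrow> snd c p \<in> chart_image c"
  unfolding chart_image_def by blast

lemma open_chart_image: "c \<in> J \<Longrightarrow> open (chart_image c)"
  using chart unfolding is_chart_def by blast

lemma N_chart: "c \<in> J \<Longrightarrow> z \<in> chart_image c \<Longrightarrow> N (chart_inv c z) = cmod (f c z) / r c z"
  using N[of c "chart_inv c z"] chart_inv_in[of z c] by simp

lemma N_nonneg: "p \<in> topspace X \<Longrightarrow> N p \<ge> 0"
  using cover[of p] N r_pos coordinate_in by (metis divide_nonneg_pos norm_ge_zero)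

lemma N_continuous: "continuous_map X euclideanreal N"
proof (rule continuous_map_from_charts)
  fix p assume "p \<in> topspace X"
  then obtain c where c: "c \<in> J" "p \<in> fst c" using cover by blast
  have "continuous_on (chart_image c) (\<lambda>z. cmod (f c z) / r c z)"
    using r_continuous[OF c(1)] holomorphic_on_imp_continuous_on[OF f_holomorphic[OF c(1)]]
      r_pos[OF c(1)]
    by (intro continuous_intros) (auto simp: less_imp_neq[THEN not_sym])
  then have "continuous_on (chart_image c) (N \<circ> chart_inv c)"
    by (rule continuous_on_cong[THEN iffD1, rotated -1]) (auto simp: N_chart[OF c(1)])
  then show "\<exists>c :: ('s, complex) chart.
      p \<in> fst c \<and> is_chart X c \<and> continuous_on (chart_image c) (N \<circ> chart_inv c)"
    using c chart[OF c(1)] by (intro exI[of _ c] conjI)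
qed

lemma u_cont:
  assumes "t > 0"
  shows "continuous_map X euclideanreal (u t)"
proof (rule continuous_map_from_charts)
  fix p assume "p \<in> topspace X"
  then obtain c where c: "c \<in> J" "p \<in> fst c" using cover by blast
  then show "\<exists>c :: ('s, complex) chart.
      p \<in> fst c \<and> is_chart X c \<and> continuous_on (chart_image c) (u t \<circ> chart_inv c)"
    using chart[OF c(1)] u_continuous[OF assms c(1)] by (intro exI[of _ c] conjI)
qed

lemma N_pos_exists: "\<exists>p\<in>topspace X. N p > 0"
proof -
  obtain c z where c: "c \<in> J" "z \<in> chart_image c" "f c z \<noteq> 0" using f_nonzero by blast
  then have "N (chart_inv c z) > 0" using N_chart[OF c(1,2)] r_pos[OF c(1,2)] by simp
  moreover have "chart_inv c z \<in> topspace X" using chart_inv_in[OF c(2)] chart_subset[OF c(1)] by auto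
  ultimately show ?thesis by blast
qed

lemma topspace_nonempty: "topspace X \<noteq> {}"
  using N_pos_exists by auto

lemma laplacian_eq:
  assumes "t > 0" "c \<in> J" "p \<in> fst c"
  shows "has_laplacian (u t \<circ> chart_inv c)
    (r c (snd c p) * (exp (2 * u t p) * (1 - (lam t p)\<^sup>2) - 1)) (snd c p)"
proof -
  have "exp (2 * u t p) * (exp (- 2 * u t p))\<^sup>2 = exp (- 2 * u t p)"
    by (simp add: power2_eq_square flip: exp_add)
  then have "exp (2 * u t p) * (1 - (lam t p)\<^sup>2) = exp (2 * u t p) - exp (- 2 * u t p) * (t * N p)\<^sup>2"
    unfolding lam_def power_mult_distrib by (simp add: algebra_simps)
  then show ?thesis using laplacian_u[OF assms] by (simp add: algebra_simps)
qed

lemma laplacian_ln_N: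
  assumes "c \<in> J" "z \<in> chart_image c" "f c z \<noteq> 0"
  shows "has_laplacian (\<lambda>z. ln (cmod (f c z)) - ln (r c z)) (- 2 * r c z) z"
  using has_laplacian_add[OF
      has_laplacian_ln_norm_holomorphic[OF f_holomorphic[OF assms(1)] open_chart_image[OF assms(1)] assms(2,3)]
      has_laplacian_cmult[OF laplacian_ln_r[OF assms(1,2)], of "-1"]]
  by simp

text \<open>Away from the zeros \<open>\<Delta>\<^sub>h ln \<parallel>q\<parallel> = -2\<close>, so that the second derivative test applies to
  \<open>ln \<parallel>q\<parallel> - a u\<close>.\<close>

lemma curvature_at_max:
  assumes "t > 0" "a > 0" "p \<in> topspace X" "N p > 0"
    and mx: "\<And>q. q \<in> topspace X \<Longrightarrow> N q * exp (- a * u t q) \<le> N p * exp (- a * u t p)"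
  shows "exp (2 * u t p) * (1 - (lam t p)\<^sup>2) \<ge> 1 - 2 / a"
proof -
  obtain c where c: "c \<in> J" "p \<in> fst c" using cover assms by blast
  define z where "z = snd c p"
  have z: "z \<in> chart_image c" "chart_inv c z = p"
    using coordinate_in[OF c(2)] chart_inv_coordinate[OF chart c(2)] c(1) by (simp_all add: z_def)
  have rz: "r c z > 0" using r_pos c z by blast
  have fz: "f c z \<noteq> 0" using N_chart[OF c(1) z(1)] z(2) assms(4) by auto
  define F where "F = (\<lambda>z. (ln (cmod (f c z)) - ln (r c z)) + (- a) * (u t \<circ> chart_inv c) z)"
  have "has_laplacian F (- 2 * r c z + (- a) *
      (r c z * (exp (2 * u t p) * (1 - (lam t p)\<^sup>2) - 1))) z"
    unfolding F_def z_def
    by (intro has_laplacian_add has_laplacian_cmult laplacian_eq laplacian_ln_N)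
      (use assms c z fz in \<open>auto simp: z_def\<close>)
  moreover have "\<forall>\<^sub>F y in nhds z. F y \<le> F z"
  proof -
    have "\<forall>\<^sub>F y in nhds z. y \<in> chart_image c"
      using open_chart_image[OF c(1)] z(1) eventually_nhds_in_open by blast
    moreover have "\<forall>\<^sub>F y in nhds z. f c y \<noteq> 0"
      using eventually_nhds_in_open[OF open_holomorphic_nonzero[OF f_holomorphic[OF c(1)]
            open_chart_image[OF c(1)]], of z] z(1) fz
      by (auto elim: eventually_mono)
    ultimately show ?thesis
    proof eventually_elim
      case (elim y)
      have F: "F y = ln (N (chart_inv c y) * exp (- a * u t (chart_inv c y)))"
        if "y \<in> chart_image c" "f c y \<noteq> 0" for y
        using that r_pos[OF c(1) that(1)] by (simp add: F_def N_chart[OF c(1)] ln_mult ln_div)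
      have "N (chart_inv c y) > 0" using elim N_chart[OF c(1)] r_pos[OF c(1)] by simp
      then show ?case
        unfolding F[OF elim] F[OF z(1) fz] z(2)
        using mx[of "chart_inv c y"] chart_inv_in[OF elim(1)] chart_subset[OF c(1)] assms(4)
        by (intro ln_le_cancel_iff[THEN iffD2]) auto
    qed
  qed
  ultimately have "- 2 * r c z + (- a) * (r c z * (exp (2 * u t p) * (1 - (lam t p)\<^sup>2) - 1)) \<le> 0"
    by (rule has_laplacian_nonpos_at_local_max)
  then have "r c z * (a * (exp (2 * u t p) * (1 - (lam t p)\<^sup>2) - 1) + 2) \<ge> 0"
    by (simp add: algebra_simps)
  then have "a * (exp (2 * u t p) * (1 - (lam t p)\<^sup>2) - 1) + 2 \<ge> 0"
    using rz by (simp add: zero_le_mult_iff)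
  then show ?thesis using \<open>a > 0\<close> by (simp add: field_simps)
qed

lemma exists_max:
  assumes "t > 0"
  obtains p where "p \<in> topspace X" "N p > 0"
    "\<And>q. q \<in> topspace X \<Longrightarrow> N q * exp (- a * u t q) \<le> N p * exp (- a * u t p)"
proof -
  have "continuous_map X euclideanreal (\<lambda>p. N p * exp (- a * u t p))"
    using continuous_map_compose[OF u_cont[OF assms], of euclideanreal "\<lambda>x. exp (- a * x)"]
    by (intro continuous_map_real_mult N_continuous) (simp add: o_def continuous_intros)
  then obtain p where p: "p \<in> topspace X"
    "\<And>q. q \<in> topspace X \<Longrightarrow> N q * exp (- a * u t q) \<le> N p * exp (- a * u t p)"
    by (rule continuous_attains_max[OF compact topspace_nonempty]) blast
  obtain q where "q \<in> topspace X" "N q > 0" using N_pos_exists by blast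
  then have "N p * exp (- a * u t p) > 0"
    using p(2)[of q] by (meson exp_gt_zero mult_pos_pos order_less_le_trans)
  then have "N p > 0" by (simp add: zero_less_mult_iff)
  then show ?thesis using that p by blast
qed

lemma lam_nonneg: "t > 0 \<Longrightarrow> p \<in> topspace X \<Longrightarrow> lam t p \<ge> 0"
  unfolding lam_def using N_nonneg by simp

lemma lam_le_1:
  assumes "t > 0" "q \<in> topspace X"
  shows "lam t q \<le> 1"
proof -
  obtain p where p: "p \<in> topspace X" "N p > 0"
    "\<And>q. q \<in> topspace X \<Longrightarrow> N q * exp (- 2 * u t q) \<le> N p * exp (- 2 * u t p)"
    using exists_max[OF assms(1)] by metis
  have "exp (2 * u t p) * (1 - (lam t p)\<^sup>2) \<ge> 0"
    using curvature_at_max[OF assms(1) _ p(1,2), of 2] p(3) by simp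
  then have "(lam t p)\<^sup>2 \<le> 1" by (simp add: zero_le_mult_iff)
  then have "lam t p \<le> 1" by (simp add: abs_square_le_1)
  moreover have "lam t q \<le> lam t p"
    unfolding lam_def using p(3)[OF assms(2)] assms(1) by (simp add: mult.assoc)
  ultimately show ?thesis by simp
qed

text \<open>Strong maximum principle without barriers: near \<open>{\<lambda> = 1}\<close> the function \<open>-u\<close> is strictly
  subharmonic. Let \<open>z0\<close> minimise \<open>u\<close> on this set. A maximum point \<open>p\<close> of \<open>\<lambda> exp (- \<epsilon> u)\<close>
  lies in \<open>{u > u z0 - \<eta>}\<close> for small \<open>\<epsilon>\<close>, so \<open>- ln \<lambda> \<le> \<epsilon> \<eta>\<close> there, whereas \<open>curvature_at_max\<close>
  forces \<open>1 - \<lambda>\<^sup>2\<close> to be at least a fixed multiple of \<open>\<epsilon>\<close>.\<close>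

lemma lam_less_1:
  assumes t: "t > 0" and q: "q \<in> topspace X"
  shows "lam t q < 1"
proof (rule ccontr)
  assume "\<not> lam t q < 1"
  then have q1: "lam t q = 1" using lam_le_1[OF t q] by simp
  have lam_cont: "continuous_map X euclideanreal (lam t)"
    unfolding lam_def
    using continuous_map_compose[OF u_cont[OF t], of euclideanreal "\<lambda>x. exp (- 2 * x)"]
    by (intro continuous_map_real_mult N_continuous) (auto simp: o_def continuous_intros)
  define Z where "Z = {p \<in> topspace X. lam t p \<in> {1}}"
  have "closedin X Z"
    unfolding Z_def by (rule closedin_continuous_map_preimage[OF lam_cont]) auto
  then have "compactin X Z" using compact by (rule closedin_compact_space[rotated])
  then have "compact (u t ` Z)" using image_compactin[OF _ u_cont[OF t]] by simp
  moreover have "u t ` Z \<noteq> {}" using q q1 by (auto simp: Z_def)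
  ultimately obtain z0 where z0: "z0 \<in> Z" "\<And>z. z \<in> Z \<Longrightarrow> u t z0 \<le> u t z"
    using compact_attains_inf[of "u t ` Z"] by auto
  obtain pC where pC: "\<And>p. p \<in> topspace X \<Longrightarrow> u t p \<le> u t pC"
    using continuous_attains_max[OF compact topspace_nonempty u_cont[OF t]] by metis
  define C where "C = exp (2 * u t pC)"
  have "continuous_map X euclideanreal (\<lambda>p. - u t p)"
    using u_cont[OF t] by (rule continuous_map_minus)
  then obtain pB where pB: "\<And>p. p \<in> topspace X \<Longrightarrow> - u t p \<le> - u t pB"
    using continuous_attains_max[OF compact topspace_nonempty] by metis
  define B where "B = max 1 (u t z0 - u t pB)"
  define \<eta> where "\<eta> = 1 / (8 * C)"
  have C: "C > 0" and \<eta>: "\<eta> > 0" by (simp_all add: C_def \<eta>_def)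
  have B: "B > 0" "\<And>p. p \<in> topspace X \<Longrightarrow> u t z0 - u t p \<le> B"
    using pB by (force simp: B_def)+
  define W where "W = {p \<in> topspace X. u t p \<in> {..u t z0 - \<eta>}}"
  have "closedin X W"
    unfolding W_def by (rule closedin_continuous_map_preimage[OF u_cont[OF t]]) auto
  then have "compactin X W" using compact by (rule closedin_compact_space[rotated])
  then have cW: "compact (lam t ` W)" using image_compactin[OF _ lam_cont] by simp
  have W1: "lam t p < 1" if "p \<in> W" for p
  proof -
    have "p \<notin> Z" using z0(2)[of p] that \<eta> by (auto simp: W_def)
    then show ?thesis using lam_le_1[OF t, of p] that by (force simp: W_def Z_def)
  qed
  obtain m where m: "0 < m" "m < 1" "\<And>p. p \<in> W \<Longrightarrow> lam t p \<le> m"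
  proof (cases "W = {}")
    case True
    then show ?thesis using that[of "1/2"] by auto
  next
    case False
    then obtain w where w: "w \<in> W" "\<And>p. p \<in> W \<Longrightarrow> lam t p \<le> lam t w"
      using compact_attains_sup[OF cW] by auto
    show ?thesis
      using that[of "max (1/2) (lam t w)"] W1[OF w(1)] w(2) by (auto simp: le_max_iff_disj)
  qed
  define \<epsilon> where "\<epsilon> = min 1 (- ln m / (2 * B))"
  have "ln m < 0" using m by simp
  then have "0 < - ln m / (2 * B)" using B(1) by (intro divide_pos_pos) auto
  then have \<epsilon>: "\<epsilon> > 0" "\<epsilon> \<le> 1" by (auto simp: \<epsilon>_def)
  have "\<epsilon> * B \<le> - ln m / (2 * B) * B"
    using B(1) by (intro mult_right_mono) (auto simp: \<epsilon>_def)
  also have "\<dots> = - ln m / 2" using B(1) by simp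
  also have "\<dots> < - ln m" using \<open>ln m < 0\<close> by simp
  finally have \<epsilon>B: "\<epsilon> * B < - ln m" .
  obtain p where p: "p \<in> topspace X" "N p > 0"
    "\<And>q. q \<in> topspace X \<Longrightarrow> N q * exp (- (2 + \<epsilon>) * u t q) \<le> N p * exp (- (2 + \<epsilon>) * u t p)"
    using exists_max[OF t, of "2 + \<epsilon>"] by metis
  have lam_p: "lam t p > 0" unfolding lam_def using t p(2) by simp
  have exp_split: "t * (N x * exp (- (2 + \<epsilon>) * u t x)) = lam t x * exp (- \<epsilon> * u t x)" for x
    unfolding lam_def by (simp add: algebra_simps flip: exp_add)
  have "lam t z0 * exp (- \<epsilon> * u t z0) \<le> lam t p * exp (- \<epsilon> * u t p)"
    unfolding exp_split[symmetric] using p(3)[of z0] z0(1) t by (auto simp: Z_def)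
  then have "ln (exp (- \<epsilon> * u t z0)) \<le> ln (lam t p * exp (- \<epsilon> * u t p))"
    using z0(1) lam_p by (subst ln_le_cancel_iff) (auto simp: Z_def)
  then have ln_lam: "- ln (lam t p) \<le> \<epsilon> * (u t z0 - u t p)"
    using lam_p by (simp add: ln_mult algebra_simps)
  also have "\<dots> \<le> \<epsilon> * B" using B(2)[OF p(1)] \<epsilon> by simp
  finally have "ln m < ln (lam t p)" using \<epsilon>B by simp
  then have "p \<notin> W" using m lam_p by (metis ln_le_cancel_iff not_le)
  then have "u t z0 - u t p < \<eta>" using p(1) by (auto simp: W_def)
  then have "- ln (lam t p) \<le> \<epsilon> * \<eta>"
    using ln_lam \<epsilon> by (smt (verit) mult_left_mono)
  moreover have "1 - (lam t p)\<^sup>2 \<le> - 2 * ln (lam t p)"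
    using lam_p exp_ge_add_one_self[of "2 * ln (lam t p)"]
    by (simp add: exp_double)
  ultimately have "1 - (lam t p)\<^sup>2 \<le> 2 * (\<epsilon> * \<eta>)" by simp
  then have "exp (2 * u t p) * (1 - (lam t p)\<^sup>2) \<le> C * (2 * (\<epsilon> * \<eta>))"
    using lam_le_1[OF t p(1)] lam_p pC[OF p(1)]
    by (intro mult_mono) (auto simp: C_def abs_square_le_1)
  also have "\<dots> = \<epsilon> / 4" using C by (simp add: \<eta>_def)
  finally have "1 - 2 / (2 + \<epsilon>) \<le> \<epsilon> / 4"
    using curvature_at_max[OF t _ p(1,2), of "2 + \<epsilon>"] p(3) \<epsilon> by simp
  moreover have "1 - 2 / (2 + \<epsilon>) = \<epsilon> / (2 + \<epsilon>)" using \<epsilon> by (simp add: field_simps)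
  moreover have "\<epsilon> / (2 + \<epsilon>) \<ge> \<epsilon> / 3" using \<epsilon> by (intro divide_left_mono) auto
  ultimately show False using \<epsilon>(1) by simp
qed

lemma curvature_lower_bound: "t > 0 \<Longrightarrow> p \<in> topspace X \<Longrightarrow> 0 < 1 - (lam t p)\<^sup>2"
  using lam_less_1 lam_nonneg by (simp add: abs_square_less_1)

lemma u_comparison:
  assumes st: "0 < s" "s < t" and q: "q \<in> topspace X"
  shows "u t q - ln t / 2 < u s q - ln s / 2"
proof -
  have t: "t > 0" using st by simp
  have "continuous_map X euclideanreal (\<lambda>p. u t p - u s p)"
    by (intro continuous_map_diff u_cont t st)
  then obtain p where p: "p \<in> topspace X"
      "\<And>q. q \<in> topspace X \<Longrightarrow> u t q - u s q \<le> u t p - u s p"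
    by (rule continuous_attains_max[OF compact topspace_nonempty]) blast
  obtain c where c: "c \<in> J" "p \<in> fst c" using cover p by blast
  define z where "z = snd c p"
  have z: "z \<in> chart_image c" "chart_inv c z = p"
    using coordinate_in[OF c(2)] chart_inv_coordinate[OF chart c(2)] c(1) by (simp_all add: z_def)
  let ?A = "\<lambda>t. exp (2 * u t p) * (1 - (lam t p)\<^sup>2)"
  have "has_laplacian (\<lambda>z. (u t \<circ> chart_inv c) z + (- 1) * (u s \<circ> chart_inv c) z)
      (r c z * (?A t - 1) + (- 1) * (r c z * (?A s - 1))) z"
    unfolding z_def by (intro has_laplacian_add has_laplacian_cmult laplacian_eq t st c)
  moreover have "\<forall>\<^sub>F y in nhds z. (u t \<circ> chart_inv c) y + (- 1) * (u s \<circ> chart_inv c) y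
      \<le> (u t \<circ> chart_inv c) z + (- 1) * (u s \<circ> chart_inv c) z"
    using eventually_nhds_in_open[OF open_chart_image[OF c(1)] z(1)]
  proof eventually_elim
    case (elim y)
    then show ?case
      using p(2)[of "chart_inv c y"] chart_inv_in[OF elim] chart_subset[OF c(1)] z(2) by auto
  qed
  ultimately have "r c z * (?A t - 1) + (- 1) * (r c z * (?A s - 1)) \<le> 0"
    by (rule has_laplacian_nonpos_at_local_max)
  then have "r c z * (?A t - ?A s) \<le> 0" by (simp add: algebra_simps)
  then have A: "?A t \<le> ?A s" using r_pos[OF c(1) z(1)] by (simp add: mult_le_0_iff)
  have "u t p - ln t / 2 < u s p - ln s / 2"
  proof (rule ccontr)
    assume "\<not> ?thesis"
    then have le: "2 * u s p + ln t \<le> 2 * u t p + ln s" by simp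
    have "exp (2 * u s p) * t \<le> exp (2 * u t p) * s"
      using le t st by (metis exp_add exp_ln exp_le_cancel_iff)
    then have e: "exp (2 * u s p) * (t / s) \<le> exp (2 * u t p)" using st by (simp add: field_simps)
    have "- 2 * u t p + ln t \<le> - 2 * u s p + ln s" using le by simp
    then have "exp (- 2 * u t p) * t \<le> exp (- 2 * u s p) * s"
      using t st by (metis exp_add exp_ln exp_le_cancel_iff)
    then have "lam t p \<le> lam s p"
      unfolding lam_def using mult_left_mono[OF _ N_nonneg[OF p(1)]]
      by (metis mult.assoc mult.commute)
    then have "1 - (lam s p)\<^sup>2 \<le> 1 - (lam t p)\<^sup>2"
      using lam_nonneg[OF t p(1)] by (simp add: power_mono)
    then have "exp (2 * u s p) * (t / s) * (1 - (lam s p)\<^sup>2) \<le> ?A t"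
      using e curvature_lower_bound[OF st(1) p(1)] by (intro mult_mono) auto
    moreover have "?A s * 1 < ?A s * (t / s)"
      using curvature_lower_bound[OF st(1) p(1)] st by (intro mult_strict_left_mono) auto
    ultimately show False using A by (simp add: mult_ac)
  qed
  then show ?thesis using p(2)[OF q] by simp
qed

lemma lam_strict_mono:
  assumes "p \<in> topspace X" "N p > 0"
  shows "strict_mono_on {0<..} (\<lambda>t. lam t p)"
proof (rule strict_mono_onI)
  fix s t :: real assume "s \<in> {0<..}" "t \<in> {0<..}" "s < t"
  then have st: "0 < s" "0 < t" "s < t" by auto
  then have "- 2 * u s p + ln s < - 2 * u t p + ln t"
    using u_comparison[OF st(1,3) assms(1)] by simp
  then have "exp (- 2 * u s p) * s < exp (- 2 * u t p) * t"
    using st by (metis exp_add exp_ln exp_less_cancel_iff)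
  then show "lam s p < lam t p"
    using assms(2) unfolding lam_def by (simp add: mult.assoc mult.left_commute mult.commute)
qed

text \<open>Upper barrier \<open>x + \<kappa> + K |z - z0|\<^sup>2\<close> for \<open>u - (ln t) / 2\<close> on a disc without zeros, with
  \<open>x = (ln \<parallel>q\<parallel>) / 2\<close> the value at which \<open>\<lambda> = 1\<close>. The constant \<open>K\<close> does not depend on \<open>t\<close>,
  since by \<open>u_comparison\<close> the boundary values are controlled by \<open>u 1\<close>.\<close>

lemma u_upper_bound:
  assumes p: "p \<in> topspace X" "N p > 0" and \<kappa>: "\<kappa> > 0"
  shows "\<forall>\<^sub>F t in at_top. u t p - ln t / 2 \<le> ln (N p) / 2 + \<kappa>"
proof -
  obtain c where c: "c \<in> J" "p \<in> fst c" using cover p by blast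
  define z0 where "z0 = snd c p"
  have z0: "z0 \<in> chart_image c" "chart_inv c z0 = p"
    using coordinate_in[OF c(2)] chart_inv_coordinate[OF chart c(2)] c(1) by (simp_all add: z0_def)
  have fz0: "f c z0 \<noteq> 0" using N_chart[OF c(1) z0(1)] z0(2) p(2) by auto
  define D where "D = {z \<in> chart_image c. f c z \<noteq> 0}"
  have "open D" unfolding D_def
    by (rule open_holomorphic_nonzero[OF f_holomorphic[OF c(1)] open_chart_image[OF c(1)]])
  moreover have "z0 \<in> D" using z0 fz0 by (simp add: D_def)
  ultimately obtain R where R: "R > 0" "cball z0 R \<subseteq> D" using open_contains_cball by blast
  have D: "z \<in> chart_image c" "f c z \<noteq> 0" "r c z > 0" if "z \<in> cball z0 R" for z
    using that R(2) r_pos[OF c(1)] by (auto simp: D_def)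
  define x where "x = (\<lambda>z. (ln (cmod (f c z)) - ln (r c z)) / 2)"
  have x_N: "x z = ln (N (chart_inv c z)) / 2" if "z \<in> cball z0 R" for z
    using D[OF that] N_chart[OF c(1)] by (simp add: x_def ln_div)
  have sub: "cball z0 R \<subseteq> chart_image c" using D by blast
  have cont_f: "continuous_on (cball z0 R) (f c)"
    using holomorphic_on_imp_continuous_on[OF f_holomorphic[OF c(1)]] continuous_on_subset sub by blast
  have cont_x: "continuous_on (cball z0 R) x"
    unfolding x_def using continuous_on_subset[OF r_continuous[OF c(1)] sub] D cont_f
    by (intro continuous_intros) (auto simp: less_imp_neq[THEN not_sym])
  have cont_u: "continuous_on (cball z0 R) (\<lambda>z. u t (chart_inv c z))" if "t > 0" for t
    using continuous_on_subset[OF u_continuous[OF that c(1)] sub] by (simp add: o_def)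
  obtain m where m: "m > 0" "\<And>z. z \<in> cball z0 R \<Longrightarrow> m \<le> cmod (f c z)"
  proof -
    have "continuous_on (cball z0 R) (\<lambda>z. cmod (f c z))" by (intro continuous_intros cont_f)
    then obtain w where "w \<in> cball z0 R" "\<forall>z\<in>cball z0 R. cmod (f c w) \<le> cmod (f c z)"
      using continuous_attains_inf[of "cball z0 R"] R(1) by force
    then show ?thesis using that[of "cmod (f c w)"] D by auto
  qed
  obtain K where K: "K > 0" "\<And>z. z \<in> cball z0 R \<Longrightarrow> u 1 (chart_inv c z) - x z \<le> K * R\<^sup>2"
  proof -
    have "continuous_on (cball z0 R) (\<lambda>z. u 1 (chart_inv c z) - x z)"
      by (intro continuous_intros cont_u cont_x) auto
    then obtain w where w: "\<forall>z\<in>cball z0 R. u 1 (chart_inv c z) - x z \<le> u 1 (chart_inv c w) - x w"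
      using continuous_attains_sup[of "cball z0 R"] R(1) by force
    let ?K = "max 1 ((u 1 (chart_inv c w) - x w) / R\<^sup>2)"
    have "u 1 (chart_inv c w) - x w \<le> ?K * R\<^sup>2"
      using R(1) by (simp add: pos_divide_le_eq[symmetric])
    then show ?thesis using w by (intro that[of ?K]) (auto intro: order_trans)
  qed
  define T where "T = max 1 (4 * K / (m * (1 - exp (- 4 * \<kappa>))))"
  have "u t p - ln t / 2 \<le> ln (N p) / 2 + \<kappa>" if "t > T" for t
  proof (rule ccontr)
    assume neg: "\<not> ?thesis"
    have t: "t > 1" "t > 0" "t > 4 * K / (m * (1 - exp (- 4 * \<kappa>)))" using that by (auto simp: T_def)
    define \<psi> where "\<psi> = (\<lambda>z. u t (chart_inv c z) - x z - K * (cmod (z - z0))\<^sup>2)"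
    have "continuous_on (cball z0 R) \<psi>"
      unfolding \<psi>_def by (intro continuous_intros cont_u cont_x t)
    then obtain z where z: "z \<in> cball z0 R" "\<And>y. y \<in> cball z0 R \<Longrightarrow> \<psi> y \<le> \<psi> z"
      using continuous_attains_sup[of "cball z0 R" \<psi>] R(1) by force
    have "\<psi> z0 > ln t / 2 + \<kappa>" using neg z0(2) x_N[of z0] R(1) by (simp add: \<psi>_def)
    then have \<psi>z: "\<psi> z > ln t / 2 + \<kappa>" using z(2)[of z0] R(1) by simp
    define w where "w = chart_inv c z"
    have w: "w \<in> fst c" "snd c w = z" "w \<in> topspace X"
      using chart_inv_in[OF D(1)[OF z(1)]] chart_subset[OF c(1)] by (auto simp: w_def)
    have "cmod (z - z0) \<noteq> R"
    proof
      assume "cmod (z - z0) = R"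
      then have "u t w - ln t / 2 > x z + K * R\<^sup>2"
        using \<psi>z \<kappa> by (simp add: \<psi>_def w_def)
      moreover have "u t w - ln t / 2 < u 1 w" using u_comparison[of 1 t w] t w by simp
      ultimately show False using K(2)[OF z(1)] by (simp add: w_def)
    qed
    then have "z \<in> ball z0 R" using z(1) by (simp add: dist_norm norm_minus_commute)
    have "has_laplacian (\<lambda>y. (u t \<circ> chart_inv c) y +
        ((- 1 / 2) * (ln (cmod (f c y)) - ln (r c y)) + (- K) * (cmod (y - z0))\<^sup>2))
      (r c z * (exp (2 * u t w) * (1 - (lam t w)\<^sup>2) - 1) +
        ((- 1 / 2) * (- 2 * r c z) + (- K) * 4)) z"
      unfolding w(2)[symmetric]
      by (intro has_laplacian_add has_laplacian_cmult laplacian_eq laplacian_ln_N has_laplacian_norm_square)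
        (use t c w D[OF z(1)] in auto)
    moreover have "(\<lambda>y. (u t \<circ> chart_inv c) y +
        ((- 1 / 2) * (ln (cmod (f c y)) - ln (r c y)) + (- K) * (cmod (y - z0))\<^sup>2)) = \<psi>"
      by (simp add: \<psi>_def x_def fun_eq_iff field_simps)
    moreover have "\<forall>\<^sub>F y in nhds z. \<psi> y \<le> \<psi> z"
      using eventually_nhds_in_open[OF open_ball \<open>z \<in> ball z0 R\<close>] by eventually_elim (use z(2) in auto)
    ultimately have "r c z * (exp (2 * u t w) * (1 - (lam t w)\<^sup>2) - 1) +
        ((- 1 / 2) * (- 2 * r c z) + (- K) * 4) \<le> 0"
      using has_laplacian_nonpos_at_local_max by metis
    then have le: "r c z * (exp (2 * u t w) * (1 - (lam t w)\<^sup>2)) \<le> 4 * K"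
      by (simp add: algebra_simps)
    have Nw: "N w > 0" "r c z * N w = cmod (f c z)"
      using N_chart[OF c(1) D(1)[OF z(1)]] D[OF z(1)] by (simp_all add: w_def)
    have "x z + \<kappa> + ln t / 2 \<le> u t w"
    proof -
      have "K * (cmod (z - z0))\<^sup>2 \<ge> 0" using K(1) by simp
      then show ?thesis using \<psi>z by (simp add: \<psi>_def w_def)
    qed
    then have uw: "ln (N w) + ln t + 2 * \<kappa> \<le> 2 * u t w" using x_N[OF z(1)] by (simp add: w_def)
    then have "exp (ln (N w) + ln t) \<le> exp (2 * u t w)" using \<kappa> by simp
    then have e1: "N w * t \<le> exp (2 * u t w)" using Nw t by (simp add: exp_add)
    have "ln t + ln (N w) + - 2 * u t w \<le> - 2 * \<kappa>" using uw by simp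
    then have "exp (ln t + ln (N w) + - 2 * u t w) \<le> exp (- 2 * \<kappa>)" by simp
    then have "lam t w \<le> exp (- 2 * \<kappa>)"
      unfolding exp_add lam_def using Nw t by simp
    then have "(lam t w)\<^sup>2 \<le> (exp (- 2 * \<kappa>))\<^sup>2"
      using lam_nonneg[OF t(2) w(3)] by (rule power_mono)
    also have "(exp (- 2 * \<kappa>))\<^sup>2 = exp (- 4 * \<kappa>)" by (simp add: power2_eq_square flip: exp_add)
    finally have e2: "1 - exp (- 4 * \<kappa>) \<le> 1 - (lam t w)\<^sup>2" by simp
    have \<kappa>4: "1 - exp (- 4 * \<kappa>) > 0" using \<kappa> by simp
    have "m * (1 - exp (- 4 * \<kappa>)) * t \<le> cmod (f c z) * (1 - exp (- 4 * \<kappa>)) * t"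
      using m(2)[OF z(1)] \<kappa>4 t by (intro mult_right_mono) auto
    also have "\<dots> = r c z * ((N w * t) * (1 - exp (- 4 * \<kappa>)))" by (simp flip: Nw(2))
    also have "\<dots> \<le> r c z * (exp (2 * u t w) * (1 - (lam t w)\<^sup>2))"
      using e1 e2 \<kappa>4 D(3)[OF z(1)] by (intro mult_left_mono mult_mono) auto
    also have "\<dots> \<le> 4 * K" by (rule le)
    finally show False using t(3) m(1) \<kappa>4 by (simp add: field_simps)
  qed
  then show ?thesis by (rule eventually_mono[OF eventually_gt_at_top[of T]])
qed

lemma lam_tendsto_1:
  assumes p: "p \<in> topspace X" "N p > 0"
  shows "((\<lambda>t. lam t p) \<longlongrightarrow> 1) at_top"
proof (rule order_tendstoI)
  fix a :: real assume "1 < a"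
  show "\<forall>\<^sub>F t in at_top. lam t p < a"
    using eventually_gt_at_top[of 0]
  proof eventually_elim
    case (elim t)
    then show ?case using lam_less_1[OF elim p(1)] \<open>1 < a\<close> by simp
  qed
next
  fix a :: real assume "a < 1"
  define b where "b = max a (1 / 2)"
  define \<kappa> where "\<kappa> = - ln b / 4"
  have b: "0 < b" "b < 1" "a \<le> b" using \<open>a < 1\<close> by (auto simp: b_def)
  then have "\<kappa> > 0" by (simp add: \<kappa>_def)
  from u_upper_bound[OF p this] eventually_gt_at_top[of 0]
  show "\<forall>\<^sub>F t in at_top. a < lam t p"
  proof eventually_elim
    case (elim t)
    then have "ln b < ln t + ln (N p) + - 2 * u t p" using \<open>\<kappa> > 0\<close> by (simp add: \<kappa>_def)
    then have "exp (ln b) < exp (ln t + ln (N p) + - 2 * u t p)" by simp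
    then have "b < lam t p" unfolding exp_add lam_def using b elim p by simp
    then show ?case using b by simp
  qed
qed

end

section \<open>The principal curvature in conformal coordinates\<close>

lemma maximal_atlas_cover:
  assumes "maximal_atlas R M" "p \<in> topspace (mtop M)"
  shows "chart_at M p \<in> charts M" "p \<in> fst (chart_at M p)"
proof -
  have "\<exists>c. c \<in> charts M \<and> p \<in> fst c" using assms unfolding maximal_atlas_def by blast
  from someI_ex[OF this] show "chart_at M p \<in> charts M" "p \<in> fst (chart_at M p)"
    unfolding chart_at_def by auto
qed

lemma open_chart_overlap:
  assumes "is_chart X c" "is_chart X d"
  shows "open (snd c ` (fst c \<inter> fst d))"
proof -
  have "openin (subtopology X (fst c)) (fst c \<inter> fst d)"
    using assms unfolding is_chart_def by (meson openin_subtopology_Int2)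
  then have "openin (top_of_set (chart_image c)) (snd c ` (fst c \<inter> fst d))"
    using assms(1) homeomorphic_imp_open_map unfolding is_chart_def open_map_def by blast
  then show ?thesis using assms(1) openin_open_trans unfolding is_chart_def by blast
qed

lemma frechet_derivative_change_chart:
  fixes F :: "'s \<Rightarrow> 'b::real_normed_vector"
  assumes c: "is_chart X c" and d: "is_chart X d" and p: "p \<in> fst c \<inter> fst d"
    and smooth: "smooth_compatible c d"
    and F: "(F \<circ> chart_inv d) differentiable (at (snd d p))"
  shows "frechet_derivative (F \<circ> chart_inv c) (at (snd c p)) v =
    frechet_derivative (F \<circ> chart_inv d) (at (snd d p))
      (frechet_derivative (transition c d) (at (snd c p)) v)"
proof -
  let ?U = "snd c ` (fst c \<inter> fst d)" and ?T = "transition c d"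
  have T: "?T (snd c y) = snd d y" if "y \<in> fst c \<inter> fst d" for y
    using that chart_inv_coordinate[OF c] by (simp add: in_charts_def)
  have "(?T has_derivative frechet_derivative ?T (at (snd c p))) (at (snd c p))"
    using smooth p smooth_onD frechet_derivative_works unfolding smooth_compatible_def by blast
  moreover have "((F \<circ> chart_inv d) has_derivative frechet_derivative (F \<circ> chart_inv d) (at (snd d p)))
      (at (?T (snd c p)))"
    using F frechet_derivative_works T[OF p] by metis
  ultimately have "((F \<circ> chart_inv d) \<circ> ?T has_derivative
      frechet_derivative (F \<circ> chart_inv d) (at (snd d p)) \<circ> frechet_derivative ?T (at (snd c p)))
      (at (snd c p))"
    by (rule diff_chain_at)
  then have "(F \<circ> chart_inv c has_derivative
      frechet_derivative (F \<circ> chart_inv d) (at (snd d p)) \<circ> frechet_derivative ?T (at (snd c p)))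
      (at (snd c p))"
  proof (rule has_derivative_transform_within_open)
    show "open ?U" by (rule open_chart_overlap[OF c d])
    show "((F \<circ> chart_inv d) \<circ> ?T) x = (F \<circ> chart_inv c) x" if "x \<in> ?U" for x
      using that T chart_inv_coordinate[OF c] chart_inv_coordinate[OF d] by auto
  qed (use p in auto)
  from frechet_derivative_at[OF this, symmetric] show ?thesis by simp
qed

lemma endo_det_compose:
  assumes "linear A"
  shows "endo_det (A \<circ> B) = endo_det A * endo_det B"
  using complex_linear_expand[OF assms, of "B 1"] complex_linear_expand[OF assms, of "B \<i>"]
  by (simp add: endo_det_def algebra_simps)

lemma linear_endo_det_surj:
  assumes "linear A" "endo_det A \<noteq> 0"
  obtains v where "A v = w"
proof -
  let ?v = "Complex ((Re w * Im (A \<i>) - Re (A \<i>) * Im w) / endo_det A)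
     ((Re (A 1) * Im w - Re w * Im (A 1)) / endo_det A)"
  have "A ?v = w"
    unfolding complex_linear_expand[OF assms(1), of ?v] complex_eq_iff
    using assms(2) by (auto simp: divide_simps) (auto simp: endo_det_def algebra_simps)
  then show ?thesis by (rule that)
qed

lemma linear_endo_det_inj:
  assumes "linear A" "endo_det A \<noteq> 0" "A v = A w"
  shows "v = w"
proof -
  have "A (v - w) = 0" using assms by (simp add: linear_diff)
  then have 1: "Re (v - w) * Re (A 1) + Im (v - w) * Re (A \<i>) = 0"
    "Re (v - w) * Im (A 1) + Im (v - w) * Im (A \<i>) = 0"
    using complex_linear_expand[OF assms(1), of "v - w"] by (auto simp: complex_eq_iff)
  have e: "Re (v - w) * endo_det A = (Re (v - w) * Re (A 1) + Im (v - w) * Re (A \<i>)) * Im (A \<i>)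
      - (Re (v - w) * Im (A 1) + Im (v - w) * Im (A \<i>)) * Re (A \<i>)"
    "Im (v - w) * endo_det A = (Re (v - w) * Im (A 1) + Im (v - w) * Im (A \<i>)) * Re (A 1)
      - (Re (v - w) * Re (A 1) + Im (v - w) * Re (A \<i>)) * Im (A 1)"
    unfolding endo_det_def by (simp_all add: algebra_simps)
  have "Re (v - w) * endo_det A = 0" "Im (v - w) * endo_det A = 0"
    unfolding e 1 by simp_all
  then show ?thesis using assms(2) by (simp add: complex_eq_iff)
qed

lemma linear_functional_inner:
  fixes \<Lambda> :: "complex \<Rightarrow> real"
  assumes "linear \<Lambda>"
  shows "\<Lambda> w = Complex (\<Lambda> 1) (\<Lambda> \<i>) \<bullet> w"
  using complex_linear_expand[OF assms, of w] by (simp add: inner_complex_def mult.commute)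

text \<open>The shape operator in \<open>chart_at S p\<close> is conjugate to the one in a conformal coordinate, where
  it is the antilinear map \<open>v \<mapsto> cnj (Q v) / (e\<^bsup>2u\<^esup> k)\<close>.\<close>

lemma principal_curvature_eq:
  fixes M :: "('m, real ^ 3) mfd" and S :: "('s, complex) mfd"
  assumes S: "closed_oriented_surface S" and h: "metric_tensor S h" and M: "ads_manifold M g"
    and mx: "maximal_surface S M g \<sigma> \<nu>"
    and c: "c \<in> charts S" "p \<in> fst c"
    and conf: "k > 0" "\<And>v w. h c (snd c p) v w = k * (v \<bullet> w)"
    and I: "\<And>c p v w. c \<in> charts S \<Longrightarrow> p \<in> fst c \<Longrightarrow>
        first_form M g \<sigma> c p v w = exp (2 * u p) * h c (snd c p) v w"
    and B: "\<And>v w. first_form M g \<sigma> c p (shape_operator M g \<sigma> \<nu> c p v) w = Re (Q * v * w)"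
  shows "principal_curvature S M g \<sigma> \<nu> p = cmod Q / k * exp (- 2 * u p)"
proof -
  have atlas: "maximal_atlas oriented_compatible S" using S unfolding closed_oriented_surface_def by blast
  then have chart: "is_chart (mtop S) c" if "c \<in> charts S" for c using that unfolding maximal_atlas_def by blast
  have pS: "p \<in> topspace (mtop S)" using c chart openin_subset unfolding is_chart_def by blast
  define b where "b = chart_at S p"
  have b: "b \<in> charts S" "p \<in> fst b" using maximal_atlas_cover[OF atlas pS] by (simp_all add: b_def)
  have emb: "smooth_map S M \<sigma>" using mx unfolding maximal_surface_def smooth_embedding_def by blast
  have \<sigma>p: "\<sigma> p \<in> topspace (mtop M)"
    using emb pS unfolding smooth_map_def continuous_map_def by auto
  define d where "d = chart_at M (\<sigma> p)"
  have "maximal_atlas smooth_compatible M" using M unfolding ads_manifold_def smooth_manifold_def by blast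
  then have d: "d \<in> charts M" "\<sigma> p \<in> fst d" using maximal_atlas_cover \<sigma>p by (auto simp: d_def)
  have gd: "bilinear (g d (snd d (\<sigma> p)))"
  proof -
    have "snd d (\<sigma> p) \<in> chart_image d" using d(2) unfolding chart_image_def by blast
    then show ?thesis
      using M d(1) unfolding ads_manifold_def lorentzian_metric_def metric_tensor_def by blast
  qed
  have oc: "oriented_compatible b c" using atlas b c unfolding maximal_atlas_def by blast
  define T where "T = frechet_derivative (transition b c) (at (snd b p))"
  have detT: "endo_det T > 0" using oc b c unfolding oriented_compatible_def T_def by blast
  have sc: "smooth_compatible b c" using oc unfolding oriented_compatible_def by blast
  have "transition b c differentiable (at (snd b p))"
    using smooth_onD sc b c unfolding smooth_compatible_def by blast
  then have linT: "linear T"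
    unfolding T_def using frechet_derivative_works has_derivative_linear by blast
  have pin: "snd c p \<in> snd c ` (fst c \<inter> \<sigma> -` fst d)" using c d by blast
  have d\<sigma>: "(snd d \<circ> \<sigma> \<circ> chart_inv c) differentiable (at (snd c p))"
    using smooth_onD[OF _ pin] emb c d unfolding smooth_map_def in_charts_def by blast
  have d\<nu>: "(\<nu> d \<circ> chart_inv c) differentiable (at (snd c p))"
    using smooth_onD[OF _ pin] mx c d unfolding maximal_surface_def unit_normal_field_def by blast
  have PF: "push_forward M \<sigma> b p v = push_forward M \<sigma> c p (T v)" for v
    using frechet_derivative_change_chart[OF chart[OF b(1)] chart[OF c(1)] _ sc d\<sigma>, of v] b c
    by (simp add: push_forward_def in_charts_def d_def T_def comp_assoc)
  have II: "second_form M g \<sigma> \<nu> b p v w = second_form M g \<sigma> \<nu> c p (T v) (T w)" for v w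
    using frechet_derivative_change_chart[OF chart[OF b(1)] chart[OF c(1)] _ sc d\<nu>, of v] b c
    by (simp add: second_form_def Let_def PF flip: d_def T_def)
  have lin_II: "linear (second_form M g \<sigma> \<nu> c p v)" for v
  proof -
    have lin_push: "linear (push_forward M \<sigma> c p)"
      unfolding push_forward_def in_charts_def d_def[symmetric]
      using d\<sigma> frechet_derivative_works has_derivative_linear by blast
    have "linear (g d (snd d (\<sigma> p)) x)" for x using gd unfolding bilinear_def by blast
    then show ?thesis
      unfolding second_form_def d_def[symmetric] Let_def
      by (rule linear_compose[OF lin_push, unfolded o_def])
  qed
  define E where "E = exp (2 * u p) * k"
  have E: "E > 0" using conf(1) by (simp add: E_def)
  have Ic: "first_form M g \<sigma> c p v w = E * (v \<bullet> w)" for v w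
    using I[OF c] conf(2) by (simp add: E_def)
  have Ib: "first_form M g \<sigma> b p v w = E * (T v \<bullet> T w)" for v w
  proof -
    have "h b (snd b p) v w = h c (snd c p) (T v) (T w)"
      using h b c unfolding metric_tensor_def T_def by blast
    then show ?thesis using I[OF b] conf(2) by (simp add: E_def)
  qed
  define Bc where "Bc = (\<lambda>v. of_real (1 / E) * cnj (Q * v))"
  have Bc: "shape_operator M g \<sigma> \<nu> c p v = Bc v" for v
  proof -
    have "E * (shape_operator M g \<sigma> \<nu> c p v \<bullet> w) = Re (Q * v * w)" for w
      using B[of v w] unfolding Ic .
    from this[of 1] this[of \<i>] show ?thesis
      using E by (simp add: Bc_def inner_complex_def complex_eq_iff field_simps)
  qed
  have IIc: "second_form M g \<sigma> \<nu> c p v w = E * (Bc v \<bullet> w)" for v w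
  proof -
    let ?L = "second_form M g \<sigma> \<nu> c p v"
    have "(THE y. \<forall>w. E * (y \<bullet> w) = ?L w) = Complex (?L 1 / E) (?L \<i> / E)"
    proof (rule the_equality)
      show "\<forall>w. E * (Complex (?L 1 / E) (?L \<i> / E) \<bullet> w) = ?L w"
        using E by (subst linear_functional_inner[OF lin_II]) (simp add: inner_complex_def field_simps)
      fix y assume "\<forall>w. E * (y \<bullet> w) = ?L w"
      from this[rule_format, of 1] this[rule_format, of \<i>]
      show "y = Complex (?L 1 / E) (?L \<i> / E)"
        using E by (simp add: complex_eq_iff inner_complex_def field_simps)
    qed
    then have "Bc v = Complex (?L 1 / E) (?L \<i> / E)"
      unfolding Bc[symmetric] shape_operator_def Ic .
    then show ?thesis
      using E by (subst linear_functional_inner[OF lin_II]) (simp add: inner_complex_def field_simps)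
  qed
  have TB: "T (shape_operator M g \<sigma> \<nu> b p v) = Bc (T v)" for v
  proof -
    obtain y where y: "T y = Bc (T v)" using linear_endo_det_surj[OF linT] detT by (metis less_irrefl)
    have "shape_operator M g \<sigma> \<nu> b p v = y"
      unfolding shape_operator_def II IIc Ib
    proof (rule the_equality)
      show "\<forall>w. E * (T y \<bullet> T w) = E * (Bc (T v) \<bullet> T w)" by (simp add: y)
      fix y' assume *: "\<forall>w. E * (T y' \<bullet> T w) = E * (Bc (T v) \<bullet> T w)"
      have "T y' \<bullet> z = Bc (T v) \<bullet> z" for z
        using *[rule_format] E linear_endo_det_surj[OF linT, of z] detT by (metis less_irrefl mult_left_cancel)
      then have "T y' = T y" using y by (metis inner_commute vector_eq_rdot)
      then show "y' = y" using linear_endo_det_inj[OF linT] detT by auto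
    qed
    then show ?thesis using y by simp
  qed
  have linB: "linear Bc" unfolding Bc_def by (intro linearI) (simp_all add: algebra_simps scaleR_conv_of_real)
  have "T \<circ> shape_operator M g \<sigma> \<nu> b p = Bc \<circ> T" using TB by auto
  then have "endo_det T * endo_det (shape_operator M g \<sigma> \<nu> b p) = endo_det Bc * endo_det T"
    using endo_det_compose[OF linT] endo_det_compose[OF linB] by metis
  then have "endo_det (shape_operator M g \<sigma> \<nu> b p) = endo_det Bc" using detT by simp
  also have "endo_det Bc = - (cmod Q / E)\<^sup>2"
  proof -
    have "Bc 1 = Complex (Re Q / E) (- Im Q / E)" "Bc \<i> = Complex (- Im Q / E) (- Re Q / E)"
      by (simp_all add: Bc_def complex_eq_iff)
    moreover have "(cmod Q / E)\<^sup>2 = ((Re Q)\<^sup>2 + (Im Q)\<^sup>2) / E\<^sup>2"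
      by (simp add: power_divide cmod_power2)
    ultimately show ?thesis
      by (simp add: endo_det_def power2_eq_square add_divide_distrib)
  qed
  finally have "principal_curvature S M g \<sigma> \<nu> p = cmod Q / E"
    using E by (simp add: principal_curvature_def b_def)
  then show ?thesis by (simp add: E_def exp_minus field_simps)
qed

theorem corollary3p11:
  fixes S :: "('s, complex) mfd" and \<tau> :: nat
    and h :: "('s, complex) metric" and J :: "('s, complex) chart set" and q\<^sub>1 :: "'s quad_diff"
    and M :: "real \<Rightarrow> ('m, real ^ 3) mfd" and g :: "real \<Rightarrow> ('m, real ^ 3) metric"
    and \<sigma> :: "real \<Rightarrow> 's \<Rightarrow> 'm" and \<nu> :: "real \<Rightarrow> ('m, real ^ 3) chart \<Rightarrow> 's \<Rightarrow> real ^ 3"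
  assumes "closed_oriented_surface S" and "connected_space (mtop S)"
    and "has_genus (mtop S) \<tau>" and "\<tau> \<ge> 2"
    and "hyperbolic_metric S h"
    and "compatible_complex_structure S h J"
    and "holomorphic_quad_diff J q\<^sub>1"
    and "\<exists>c\<in>J. \<exists>x\<in>chart_image c. q\<^sub>1 c x \<noteq> 0"
    and "\<And>t. t > 0 \<Longrightarrow>
      ghmc_ads_parameterised_by S h J (\<lambda>c z. of_real t * q\<^sub>1 c z) (M t) (g t) (\<sigma> t) (\<nu> t)"
  shows "\<forall>p \<in> topspace (mtop S) - quad_diff_zeros J q\<^sub>1.
    strict_mono_on {0<..} (\<lambda>t. principal_curvature S (M t) (g t) (\<sigma> t) (\<nu> t) p) \<and>
    ((\<lambda>t. principal_curvature S (M t) (g t) (\<sigma> t) (\<nu> t) p) \<longlongrightarrow> 1) at_top"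
proof -
  let ?pc = "\<lambda>t p. principal_curvature S (M t) (g t) (\<sigma> t) (\<nu> t) p"
  have JS: "c \<in> charts S" if "c \<in> J" for c
    using that assms(6) unfolding compatible_complex_structure_def by blast
  have coord: "snd c p \<in> chart_image c" if "p \<in> fst c" for c :: "('s, complex) chart" and p
    using that unfolding chart_image_def by blast
  have chart: "is_chart (mtop S) c" if "c \<in> charts S" for c
    using that assms(1) unfolding closed_oriented_surface_def maximal_atlas_def by blast
  have mt: "metric_tensor S h" using assms(5) unfolding hyperbolic_metric_def riemannian_metric_def by blast
  define r where "r = (\<lambda>c x. h c x 1 1)"
  have conf: "r c x > 0 \<and> (\<forall>v w. h c x v w = r c x * (v \<bullet> w))" if cx: "c \<in> J" "x \<in> chart_image c" for c x
  proof -
    obtain a where "a > 0" "\<forall>v w. h c x v w = a * (v \<bullet> w)"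
      using assms(6) cx unfolding compatible_complex_structure_def by blast
    then show ?thesis by (simp add: r_def)
  qed
  have r_smooth: "smooth_on (chart_image c) (r c)" if "c \<in> J" for c
    using mt JS[OF that] unfolding metric_tensor_def r_def by blast
  have cm: "conformal_metric (chart_image c) (h c) (r c)" if "c \<in> J" for c
    using conf[OF that] r_smooth[OF that] chart[OF JS[OF that]]
    by unfold_locales (auto simp: is_chart_def)
  have *: "\<exists>u. (\<forall>c\<in>charts S. smooth_on (chart_image c) (u \<circ> chart_inv c)) \<and>
          (\<forall>c\<in>J. \<forall>p\<in>fst c. laplacian (h c) (u \<circ> chart_inv c) (snd c p) =
             exp (2 * u p) - exp (- 2 * u p) * (quad_diff_norm h (\<lambda>c z. of_real t * q\<^sub>1 c z) c p)\<^sup>2 - 1) \<and>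
          (\<forall>c\<in>charts S. \<forall>p\<in>fst c. \<forall>v w.
             first_form (M t) (g t) (\<sigma> t) c p v w = exp (2 * u p) * h c (snd c p) v w)"
    (is "\<exists>u. ?P t u") if t: "t > 0" for t
  proof -
    from assms(9)[OF t, unfolded ghmc_ads_parameterised_by_def] obtain u where "?P t u"
      by (elim conjE exE) (drule that[OF conjI, OF _ conjI], assumption+)
    then show ?thesis by (rule exI[of _ u])
  qed
  define u where "u = (\<lambda>t. SOME u. ?P t u)"
  have u: "?P t (u t)" if "t > 0" for t
    unfolding u_def using someI_ex[OF *[OF that]] .
  have
    u_smooth: "t > 0 \<Longrightarrow> c \<in> charts S \<Longrightarrow> smooth_on (chart_image c) (u t \<circ> chart_inv c)" and
    u_lap: "t > 0 \<Longrightarrow> c \<in> J \<Longrightarrow> p \<in> fst c \<Longrightarrow>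
      laplacian (h c) (u t \<circ> chart_inv c) (snd c p) = exp (2 * u t p) -
        exp (- 2 * u t p) * (quad_diff_norm h (\<lambda>c z. of_real t * q\<^sub>1 c z) c p)\<^sup>2 - 1" and
    I: "t > 0 \<Longrightarrow> c \<in> charts S \<Longrightarrow> p \<in> fst c \<Longrightarrow>
      first_form (M t) (g t) (\<sigma> t) c p v w = exp (2 * u t p) * h c (snd c p) v w" for t c p v w
    using u by (auto simp: o_def)
  have pc: "?pc t p = t * (cmod (q\<^sub>1 c (snd c p)) / r c (snd c p)) * exp (- 2 * u t p)"
    if "t > 0" "c \<in> J" "p \<in> fst c" for t c p
  proof -
    have "?pc t p = cmod (of_real t * q\<^sub>1 c (snd c p)) / r c (snd c p) * exp (- 2 * u t p)"
    proof (rule principal_curvature_eq[where g = "g t" and h = h and c = c])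
      show "ads_manifold (M t) (g t)" "maximal_surface S (M t) (g t) (\<sigma> t) (\<nu> t)"
        using assms(9)[OF that(1)] unfolding ghmc_ads_parameterised_by_def ghmc_ads_def by blast+
      show "first_form (M t) (g t) (\<sigma> t) c p (shape_operator (M t) (g t) (\<sigma> t) (\<nu> t) c p v) w =
          Re (complex_of_real t * q\<^sub>1 c (snd c p) * v * w)" for v w
        using assms(9)[OF that(1)] that(2,3) unfolding ghmc_ads_parameterised_by_def by blast
    qed (use assms(1) mt JS that conf coord I in auto)
    then show ?thesis using that(1) by (simp add: norm_mult)
  qed
  define N where "N = (\<lambda>p. ?pc 1 p * exp (2 * u 1 p))"
  have N: "N p = cmod (q\<^sub>1 c (snd c p)) / r c (snd c p)" if "c \<in> J" "p \<in> fst c" for c p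
    using pc[OF zero_less_one that] by (simp add: N_def mult.assoc flip: exp_add)
  interpret quad_diff_surface "mtop S" J r q\<^sub>1 N u
  proof
    show "compact_space (mtop S)" using assms(1) unfolding closed_oriented_surface_def by blast
    show "\<exists>c\<in>J. p \<in> fst c" if "p \<in> topspace (mtop S)" for p
      using that assms(6) unfolding compatible_complex_structure_def by blast
    show "is_chart (mtop S) c" if "c \<in> J" for c by (rule chart[OF JS[OF that]])
    show "r c z > 0" if "c \<in> J" "z \<in> chart_image c" for c z using conf that by blast
    show "continuous_on (chart_image c) (r c)" if "c \<in> J" for c
      using smooth_onD[OF r_smooth[OF that]] differentiable_imp_continuous_within
      by (intro continuous_at_imp_continuous_on) blast
    show "has_laplacian (\<lambda>z. ln (r c z)) (2 * r c z) z" if "c \<in> J" "z \<in> chart_image c" for c z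
    proof -
      have *: "h c z v w = r c z * (v \<bullet> w)" "r c z > 0" for v w using conf that by blast+
      have "h c z 1 1 * h c z \<i> \<i> - (h c z 1 \<i>)\<^sup>2 \<noteq> 0"
        using *(2) unfolding *(1) by (simp add: inner_complex_def)
      then have "sectional_curvature (h c) z 1 \<i> = -1"
        using assms(5) JS[OF that(1)] that(2)
        unfolding hyperbolic_metric_def constant_sectional_curvature_def by blast
      then show ?thesis
        by (rule conformal_metric.has_laplacian_ln_conformal_factor[OF cm[OF that(1)] that(2)])
    qed
    show "q\<^sub>1 c holomorphic_on chart_image c" if "c \<in> J" for c
      using assms(7) that unfolding holomorphic_quad_diff_def by blast
    show "N p = cmod (q\<^sub>1 c (snd c p)) / r c (snd c p)" if "c \<in> J" "p \<in> fst c" for c p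
      by (rule N[OF that])
    show "\<exists>c\<in>J. \<exists>z\<in>chart_image c. q\<^sub>1 c z \<noteq> 0" by (rule assms(8))
    show "continuous_on (chart_image c) (u t \<circ> chart_inv c)" if "t > 0" "c \<in> J" for t c
      using smooth_onD[OF u_smooth[OF that(1) JS[OF that(2)]]] differentiable_imp_continuous_within
      by (intro continuous_at_imp_continuous_on) blast
    show "has_laplacian (u t \<circ> chart_inv c)
        (r c (snd c p) * (exp (2 * u t p) - exp (- 2 * u t p) * (t * N p)\<^sup>2 - 1)) (snd c p)"
      if "t > 0" "c \<in> J" "p \<in> fst c" for t c p
    proof -
      have "quad_diff_norm h (\<lambda>c z. of_real t * q\<^sub>1 c z) c p = t * N p"
        using that(1) by (simp add: quad_diff_norm_def N[OF that(2,3)] r_def norm_mult)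
      then show ?thesis
        using conformal_metric.laplacian_conformal[OF cm[OF that(2)]
            u_smooth[OF that(1) JS[OF that(2)]] coord[OF that(3)]] u_lap[OF that] by simp
    qed
  qed
  show ?thesis
  proof
    fix p assume p: "p \<in> topspace (mtop S) - quad_diff_zeros J q\<^sub>1"
    then obtain c where c: "c \<in> J" "p \<in> fst c" using cover by blast
    then have "q\<^sub>1 c (snd c p) \<noteq> 0" using p unfolding quad_diff_zeros_def by blast
    then have Np: "N p > 0" using N[OF c] r_pos[OF c(1) coord[OF c(2)]] by simp
    have lam: "lam t p = ?pc t p" if "t > 0" for t
      using pc[OF that c] by (simp add: lam_def N[OF c])
    have "strict_mono_on {0<..} (\<lambda>t. ?pc t p)"
      using lam_strict_mono[of p] p Np lam by (auto simp: strict_mono_on_def)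
    moreover have "((\<lambda>t. ?pc t p) \<longlongrightarrow> 1) at_top"
    proof (rule Lim_transform_eventually)
      show "((\<lambda>t. lam t p) \<longlongrightarrow> 1) at_top" using lam_tendsto_1 p Np by blast
      show "\<forall>\<^sub>F t in at_top. lam t p = ?pc t p"
        using eventually_gt_at_top[of 0] by eventually_elim (rule lam)
    qed
    ultimately show "strict_mono_on {0<..} (\<lambda>t. ?pc t p) \<and> ((\<lambda>t. ?pc t p) \<longlongrightarrow> 1) at_top" ..
  qed
qed

end
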